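(* Let $f,g\colon (\mathbb{C}^n,0)\to (\mathbb{C},0)$ be two holomorphic function-germs, not identically zero. Assume that there are germs of bi-Lipschitz homeomorphisms $\varphi\colon (\mathbb{C}^n,0)\to (\mathbb{C}^n,0)$ and $\phi\colon (\mathbb{C},0)\to (\mathbb{C},0)$ such that $f=\phi\circ g\circ \varphi$. Then the Milnor fibres $f_*^{-1}(1)$ and $g_*^{-1}(1)$ of the initial forms of $f$ and $g$ are homotopy equivalent.
   Context: A holomorphic function-germ $f\colon(\mathbb{C}^n,0)\to(\mathbb{C},0)$, not identically zero, is written $f=f_m+f_{m+1}+\cdots$, where each $f_j$ is identically zero or a homogeneous polynomial of degree $j$, and $f_m\neq 0$. Then $m=\mathrm{ord}_0 f$, and $f_*:=f_m$ is called the initial form of $f$. The Milnor fibre of $f_*$ is $f_*^{-1}(1)=\{x\in\mathbb{C}^n: f_*(x)=1\}$. Bi-Lipschitz is with respect to the Euclidean distance. *)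

theory Defs
  imports "HOL-Analysis.Analysis"
begin

text \<open>
  Germs at the origin are represented by total functions of which only the behaviour near \<open>0\<close>
  matters. In contrast, homogeneous polynomials, initial forms and their Milnor fibres are global.
\<close>

definition holomorphic_germ :: "(complex ^ 'n \<Rightarrow> complex) \<Rightarrow> bool" where
  "holomorphic_germ f \<longleftrightarrow>
     (\<exists>U. open U \<and> 0 \<in> U \<and>
       (\<forall>x\<in>U. \<exists>L. (f has_derivative L) (at x) \<and> (\<forall>c v. L (c *s v) = c * L v)))"

definition bilipschitz_homeo_germ :: "('a::real_normed_vector \<Rightarrow> 'a) \<Rightarrow> bool" where
  "bilipschitz_homeo_germ \<phi> \<longleftrightarrow> \<phi> 0 = 0 \<and>
     (\<exists>U V \<psi>. open U \<and> 0 \<in> U \<and> open V \<and> 0 \<in> V \<and> homeomorphism U V \<phi> \<psi> \<and>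
       (\<exists>C. C-lipschitz_on U \<phi>) \<and> (\<exists>C. C-lipschitz_on V \<psi>))"

text \<open>The zero polynomial counts as homogeneous of every degree.\<close>

definition homogeneous_poly :: "nat \<Rightarrow> (complex ^ 'n \<Rightarrow> complex) \<Rightarrow> bool" where
  "homogeneous_poly d p \<longleftrightarrow>
     (\<exists>c :: ('n \<Rightarrow> nat) \<Rightarrow> complex.
       p = (\<lambda>x. \<Sum>\<alpha> | (\<Sum>i\<in>UNIV. \<alpha> i) = d. c \<alpha> * (\<Prod>i\<in>UNIV. (x $ i) ^ \<alpha> i)))"

definition homogeneous_expansion ::
  "(complex ^ 'n \<Rightarrow> complex) \<Rightarrow> (nat \<Rightarrow> complex ^ 'n \<Rightarrow> complex) \<Rightarrow> bool" where
  "homogeneous_expansion f F \<longleftrightarrow>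
     (\<forall>j. homogeneous_poly j (F j)) \<and> (\<forall>\<^sub>F x in nhds 0. (\<lambda>j. F j x) sums f x)"

text \<open>
  A holomorphic germ has exactly one expansion into homogeneous polynomials, since \<open>F j x\<close> is the
  coefficient of \<open>t ^ j\<close> in the Taylor series of \<open>t \<mapsto> f (t x)\<close> at \<open>0\<close>.
\<close>

definition homogeneous_part ::
  "(complex ^ 'n \<Rightarrow> complex) \<Rightarrow> nat \<Rightarrow> complex ^ 'n \<Rightarrow> complex" where
  "homogeneous_part f = (THE F. homogeneous_expansion f F)"

definition ord_0 :: "(complex ^ 'n \<Rightarrow> complex) \<Rightarrow> nat" where
  "ord_0 f = (LEAST j. homogeneous_part f j \<noteq> (\<lambda>x. 0))"

definition initial_form :: "(complex ^ 'n \<Rightarrow> complex) \<Rightarrow> complex ^ 'n \<Rightarrow> complex" where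
  "initial_form f = homogeneous_part f (ord_0 f)"

definition milnor_fibre :: "(complex ^ 'n \<Rightarrow> complex) \<Rightarrow> (complex ^ 'n) set" where
  "milnor_fibre p = {x. p x = 1}"

end

theory Submission imports Defs "HOL-Complex_Analysis.Complex_Analysis" begin

text \<open>
  Blow up at the origin. Since \<open>\<phi>\<close> and \<open>\<Phi>\<close> are Lipschitz together with their inverses, along a
  suitable sequence \<open>t \<rightarrow> 0\<close> the rescalings \<open>\<phi> (t x) / t\<close> and \<open>\<Phi> (t ^ m z) / t ^ m\<close> converge to global
  homeomorphisms \<open>\<phi>0\<close> and \<open>\<Phi>0\<close> fixing the origin. Comparing growth rates shows that \<open>f\<close> and \<open>g\<close> have the
  same order \<open>m\<close>, so that \<open>f (t x) / t ^ m\<close> and \<open>g (t x) / t ^ m\<close> converge to the initial forms and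
  the relation between the germs becomes \<open>f\<^sub>* = \<Phi>0 \<circ> g\<^sub>* \<circ> \<phi>0\<close> in the limit. Hence \<open>\<phi>0\<close> maps the Milnor
  fibre of \<open>f\<^sub>*\<close> homeomorphically onto a nonzero level set of \<open>g\<^sub>*\<close>, and a homothety maps the latter onto
  the Milnor fibre of \<open>g\<^sub>*\<close>. In particular the Milnor fibres are even homeomorphic.
\<close>

no_notation fps_nth (infixl "$" 75)

section \<open>Holomorphic functions of several variables\<close>

lemma norm_vector_scalar_mult_complex: "norm (c *s (v :: complex ^ 'n)) = norm c * norm v"
  by (simp add: norm_vec_def norm_mult L2_set_right_distrib)

lemma bounded_linear_vector_scalar_mult_left: "bounded_linear (\<lambda>c. c *s (v :: complex ^ 'n))"
  by (rule bounded_linear_intro[where K = "norm v"])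
     (auto simp: vec_eq_iff algebra_simps norm_vector_scalar_mult_complex)

lemma continuous_on_vector_scalar_mult [continuous_intros]:
  fixes v :: "'a::topological_space \<Rightarrow> complex ^ 'n"
  assumes "continuous_on S c" "continuous_on S v"
  shows "continuous_on S (\<lambda>x. c x *s v x)"
  unfolding vector_scalar_mult_def using assms by (intro continuous_intros)

text \<open>The pointwise condition of \<open>holomorphic_germ\<close> with the open set as a
  parameter, so that one and the same \<open>U\<close> serves for \<open>f\<close> and for all its
  iterated directional derivatives.\<close>

definition complex_differentiable_on :: "(complex ^ 'n \<Rightarrow> complex) \<Rightarrow> (complex ^ 'n) set \<Rightarrow> bool" where
  "complex_differentiable_on f U \<longleftrightarrow>
     (\<forall>x\<in>U. \<exists>L. (f has_derivative L) (at x) \<and> (\<forall>c v. L (c *s v) = c * L v))"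

text \<open>A complex derivative in one variable, so that Cauchy's formula applies on the complex
  line through \<open>x\<close>. For a complex differentiable \<open>f\<close> it is the Frechet
  derivative at \<open>x\<close> applied to \<open>v\<close>.\<close>

definition dir_deriv :: "complex ^ 'n \<Rightarrow> (complex ^ 'n \<Rightarrow> complex) \<Rightarrow> complex ^ 'n \<Rightarrow> complex" where
  "dir_deriv v f x = deriv (\<lambda>t. f (x + t *s v)) 0"

lemma has_field_derivative_along_line:
  fixes f :: "complex ^ 'n \<Rightarrow> complex"
  assumes "(f has_derivative L) (at (x + t *s v))" "\<And>c v. L (c *s v) = c * L v"
  shows "((\<lambda>t. f (x + t *s v)) has_field_derivative L v) (at t)"
proof -
  have "((\<lambda>t. x + t *s v) has_derivative (\<lambda>t. t *s v)) (at t)"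
    using has_derivative_add[OF has_derivative_const
      bounded_linear_imp_has_derivative[OF bounded_linear_vector_scalar_mult_left]] by simp
  from diff_chain_at[OF this assms(1)]
  have "((\<lambda>t. f (x + t *s v)) has_derivative (\<lambda>t. L (t *s v))) (at t)"
    by (simp add: o_def)
  moreover have "(\<lambda>t. L (t *s v)) = (*) (L v)"
    using assms(2) by (auto simp: mult.commute)
  ultimately show ?thesis
    by (simp add: has_field_derivative_def)
qed

lemma complex_differentiable_on_D:
  assumes "complex_differentiable_on f U" "x \<in> U"
  shows "(f has_derivative (\<lambda>v. dir_deriv v f x)) (at x)"
    and "dir_deriv (c *s v) f x = c * dir_deriv v f x"
proof -
  obtain L where L: "(f has_derivative L) (at x)" "\<And>c v. L (c *s v) = c * L v"
    using assms unfolding complex_differentiable_on_def by blast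
  have "L v = dir_deriv v f x" for v
    unfolding dir_deriv_def
    using has_field_derivative_along_line[of f L x 0 v] L by (simp add: DERIV_imp_deriv)
  then have "L = (\<lambda>v. dir_deriv v f x)" by blast
  with L show "(f has_derivative (\<lambda>v. dir_deriv v f x)) (at x)"
    and "dir_deriv (c *s v) f x = c * dir_deriv v f x" by auto
qed

lemma complex_differentiable_on_along_line:
  assumes "complex_differentiable_on f U" "x + t *s v \<in> U"
  shows "((\<lambda>t. f (x + t *s v)) has_field_derivative dir_deriv v f (x + t *s v)) (at t)"
  using assms complex_differentiable_on_D by (intro has_field_derivative_along_line) blast+

lemma complex_differentiable_on_imp_continuous_on:
  assumes "complex_differentiable_on f U"
  shows "continuous_on U f"
  using complex_differentiable_on_D(1)[OF assms] has_derivative_continuous continuous_at_imp_continuous_on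
  by blast

text \<open>Cauchy's formula for the first derivative on a circle in the line through
  \<open>x\<close> in direction \<open>v\<close>. Path \<open>c\<close> and kernel \<open>w\<close>
  are the same for all \<open>x\<close> near \<open>x0\<close>, so regularity in \<open>x\<close>
  can be read off from theorems on integrals with a parameter.\<close>

lemma dir_deriv_Cauchy_integral:
  assumes f: "complex_differentiable_on f U" and U: "open U" "x0 \<in> U"
  obtains r c w where "r > 0" "continuous_on {0..1} c" "continuous_on {0..1} w"
    "\<And>x s. x \<in> ball x0 r \<Longrightarrow> s \<in> {0..1::real} \<Longrightarrow> x + c s *s v \<in> U"
    "\<And>x. x \<in> ball x0 r \<Longrightarrow> dir_deriv v f x = integral {0..1} (\<lambda>s. w s * f (x + c s *s v))"
proof -
  obtain e where e: "e > 0" "ball x0 e \<subseteq> U"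
    using U openE by blast
  \<comment> \<open>Keeps the circle within distance \<open>e / 2\<close> of its centre
    \<open>x\<close>; the summand 1 covers \<open>v = 0\<close>.\<close>
  define \<rho> where "\<rho> = e / (2 * (norm v + 1))"
  have \<rho>: "\<rho> > 0" "\<rho> * norm v < e / 2"
    using e(1) by (auto simp: \<rho>_def field_simps add_nonneg_pos add_pos_nonneg)
  have inU: "x + t *s v \<in> U" if "x \<in> ball x0 (e/2)" "norm t \<le> \<rho>" for x t
  proof -
    have "norm (t *s v) \<le> \<rho> * norm v"
      using that(2) by (simp add: norm_vector_scalar_mult_complex mult_right_mono)
    then have "dist x0 (x + t *s v) < e/2 + e/2"
      using that(1) \<rho>(2) dist_triangle[of x0 "x + t *s v" x] by (simp add: dist_norm)
    then show ?thesis using e(2) by auto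
  qed
  \<comment> \<open>The Cauchy kernel for the first derivative at 0, pulled back to the parameter
    interval and including the factor from \<open>deriv\<close>.\<close>
  define w where "w s = vector_derivative (circlepath 0 \<rho>) (at s) / (circlepath 0 \<rho> s)^2 / (2 * of_real pi * \<i>)" for s
  show ?thesis
  proof (rule that)
    show "e / 2 > 0" using e by simp
    show "continuous_on {0..1} (circlepath 0 \<rho>)"
      using path_circlepath path_def by blast
    show "continuous_on {0..1} w"
      unfolding w_def vector_derivative_circlepath using \<rho>(1)
      by (intro continuous_intros) (auto simp: circlepath intro!: continuous_intros)
    show "x + circlepath 0 \<rho> s *s v \<in> U" if "x \<in> ball x0 (e/2)" "s \<in> {0..1::real}" for x s
      using that \<rho>(1) by (intro inU) (auto simp: circlepath norm_mult)
    show "dir_deriv v f x = integral {0..1} (\<lambda>s. w s * f (x + circlepath 0 \<rho> s *s v))"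
      if x: "x \<in> ball x0 (e/2)" for x
    proof -
      let ?h = "\<lambda>t. f (x + t *s v)"
      have d: "(?h has_field_derivative dir_deriv v f (x + t *s v)) (at t)" if "t \<in> cball 0 \<rho>" for t
        using that by (intro complex_differentiable_on_along_line[OF f] inU[OF x]) auto
      have "continuous_on (cball 0 \<rho>) ?h"
        using d DERIV_isCont continuous_at_imp_continuous_on by blast
      moreover have "?h holomorphic_on ball 0 \<rho>"
        using d ball_subset_cball by (subst holomorphic_on_open) blast+
      ultimately have "contour_integral (circlepath 0 \<rho>) (\<lambda>u. ?h u / (u - 0)^2) = (2 * pi * \<i>) * deriv ?h 0"
        using \<rho>(1) by (intro Cauchy_contour_integral_circlepath_2) auto
      then have "dir_deriv v f x = contour_integral (circlepath 0 \<rho>) (\<lambda>u. ?h u / u^2) / (2 * pi * \<i>)"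
        by (simp add: dir_deriv_def)
      also have "\<dots> = integral {0..1} (\<lambda>s. w s * f (x + circlepath 0 \<rho> s *s v))"
        unfolding contour_integral_integral w_def
        by (subst integral_divide [symmetric]) (simp add: field_simps)
      finally show ?thesis .
    qed
  qed
qed

lemma continuous_on_dir_deriv:
  assumes f: "complex_differentiable_on f U" and U: "open U"
  shows "continuous_on U (dir_deriv v f)"
proof (rule continuous_at_imp_continuous_on, rule ballI)
  fix x0 assume "x0 \<in> U"
  then obtain r c w where rcw: "r > 0" "continuous_on {0..1} c" "continuous_on {0..1} w"
    "\<And>x s. x \<in> ball x0 r \<Longrightarrow> s \<in> {0..1::real} \<Longrightarrow> x + c s *s v \<in> U"
    "\<And>x. x \<in> ball x0 r \<Longrightarrow> dir_deriv v f x = integral {0..1} (\<lambda>s. w s * f (x + c s *s v))"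
    using dir_deriv_Cauchy_integral[OF f U, of x0 v] by blast
  have "continuous_on (ball x0 r) (\<lambda>x. integral (cbox 0 1) (\<lambda>s. w s * f (x + c s *s v)))"
  proof (rule integral_continuous_on_param)
    show "continuous_on (ball x0 r \<times> cbox 0 1) (\<lambda>(x, s). w s * f (x + c s *s v))"
      unfolding case_prod_unfold
      by (intro continuous_intros continuous_on_compose2[OF complex_differentiable_on_imp_continuous_on[OF f]]
           continuous_on_compose2[OF rcw(2)] continuous_on_compose2[OF rcw(3)])
         (use rcw(4) in auto)
  qed
  then have "continuous_on (ball x0 r) (dir_deriv v f)"
    by (rule continuous_on_eq) (simp add: rcw(5))
  then show "isCont (dir_deriv v f) x0"
    using rcw(1) by (simp add: continuous_on_eq_continuous_at)
qed

text \<open>Differentiation under the integral sign in Cauchy's formula. This makes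
  \<open>dir_deriv\<close> iterable, which the induction on the degree of the Taylor terms
  needs.\<close>

lemma complex_differentiable_on_dir_deriv:
  fixes f :: "complex ^ 'n \<Rightarrow> complex"
  assumes f: "complex_differentiable_on f U" and U: "open U"
  shows "complex_differentiable_on (dir_deriv v f) U"
  unfolding complex_differentiable_on_def
proof
  fix x0 assume "x0 \<in> U"
  then obtain r c w where rcw: "r > 0" "continuous_on {0..1} c" "continuous_on {0..1} w"
    "\<And>x s. x \<in> ball x0 r \<Longrightarrow> s \<in> {0..1::real} \<Longrightarrow> x + c s *s v \<in> U"
    "\<And>x. x \<in> ball x0 r \<Longrightarrow> dir_deriv v f x = integral {0..1} (\<lambda>s. w s * f (x + c s *s v))"
    using dir_deriv_Cauchy_integral[OF f U, of x0 v] by blast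
  \<comment> \<open>The derivative in \<open>x\<close> of the integrand, as a bounded linear map
    because the Leibniz rule asks for that type. \<open>Blinfun\<close> is meaningful only for
    \<open>x\<close> in the ball and \<open>s\<close> in the unit interval, hence the guarded
    evaluation rule that follows.\<close>
  define F where "F x s = Blinfun (\<lambda>h. w s * dir_deriv h f (x + c s *s v))" for x s
  have F: "blinfun_apply (F x s) = (\<lambda>h. w s * dir_deriv h f (x + c s *s v))"
    if "x \<in> ball x0 r" "s \<in> {0..1}" for x s
    unfolding F_def
    by (rule bounded_linear_Blinfun_apply, rule bounded_linear_const_mult,
        rule has_derivative_bounded_linear, rule complex_differentiable_on_D(1)[OF f rcw(4)[OF that]])
  have cont: "continuous_on (ball x0 r \<times> cbox 0 1) (\<lambda>(x, s). F x s)"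
    unfolding case_prod_unfold
  \<comment> \<open>In finite dimension it suffices to test on basis vectors, where the claim is the
    continuity of \<open>dir_deriv\<close>.\<close>
  proof (rule continuous_on_blinfun_componentwise)
    fix i :: "complex ^ 'n"
    have "continuous_on (ball x0 r \<times> cbox 0 1) (\<lambda>p. w (snd p) * dir_deriv i f (fst p + c (snd p) *s v))"
      by (intro continuous_intros continuous_on_compose2[OF continuous_on_dir_deriv[OF f U]]
           continuous_on_compose2[OF rcw(2)] continuous_on_compose2[OF rcw(3)])
         (use rcw(4) in auto)
    then show "continuous_on (ball x0 r \<times> cbox 0 1) (\<lambda>p. blinfun_apply (F (fst p) (snd p)) i)"
      by (rule continuous_on_eq) (auto simp: F)
  qed
  have x0: "x0 \<in> ball x0 r" using rcw(1) by simp
  have "((\<lambda>x. integral (cbox 0 1) (\<lambda>s. w s * f (x + c s *s v))) has_derivative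
          blinfun_apply (integral (cbox 0 1) (F x0))) (at x0 within ball x0 r)"
  proof (rule leibniz_rule[OF _ _ cont x0 convex_ball])
    fix x and s :: real assume xs: "x \<in> ball x0 r" "s \<in> cbox 0 1"
    have "((\<lambda>x. x + c s *s v) has_derivative (\<lambda>h. h)) (at x within ball x0 r)"
      by (auto intro!: derivative_eq_intros)
    from has_derivative_compose[OF this complex_differentiable_on_D(1)[OF f rcw(4)]] xs
    show "((\<lambda>x. w s * f (x + c s *s v)) has_derivative blinfun_apply (F x s)) (at x within ball x0 r)"
      by (subst F) (auto intro!: has_derivative_mult_right)
  next
    fix x assume "x \<in> ball x0 r"
    then show "(\<lambda>s. w s * f (x + c s *s v)) integrable_on cbox 0 1"
      by (intro integrable_continuous continuous_intros rcw(2)[folded cbox_interval] rcw(3)[folded cbox_interval]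
           continuous_on_compose2[OF complex_differentiable_on_imp_continuous_on[OF f]])
         (use rcw(4) in auto)
  qed
  then have "((\<lambda>x. integral (cbox 0 1) (\<lambda>s. w s * f (x + c s *s v))) has_derivative
          blinfun_apply (integral (cbox 0 1) (F x0))) (at x0)"
    using at_within_open[OF x0] by simp
  then have 1: "(dir_deriv v f has_derivative blinfun_apply (integral (cbox 0 1) (F x0))) (at x0)"
    by (rule has_derivative_transform_within_open[OF _ open_ball x0]) (simp add: rcw(5))
  have int: "F x0 integrable_on cbox 0 1"
    by (intro integrable_continuous continuous_on_compose2[OF cont, of _ "\<lambda>s. (x0, s)", simplified] continuous_intros)
       (use x0 in auto)
  \<comment> \<open>The Leibniz rule gives a real linear derivative; complex linearity holds for
    each \<open>F x0 s\<close> and passes through the integral.\<close>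
  have "blinfun_apply (integral (cbox 0 1) (F x0)) (a *s h) = a * blinfun_apply (integral (cbox 0 1) (F x0)) h" for a h
  proof -
    have "blinfun_apply (integral (cbox 0 1) (F x0)) (a *s h) = integral (cbox 0 1) (\<lambda>s. F x0 s (a *s h))"
      by (rule blinfun_apply_integral[OF int])
    also have "\<dots> = integral (cbox 0 1) (\<lambda>s. a * F x0 s h)"
      using x0 complex_differentiable_on_D(2)[OF f rcw(4)[OF x0]]
      by (intro integral_cong) (simp add: F)
    also have "\<dots> = a * blinfun_apply (integral (cbox 0 1) (F x0)) h"
      unfolding blinfun_apply_integral[OF int] by simp
    finally show ?thesis .
  qed
  with 1 show "\<exists>L. (dir_deriv v f has_derivative L) (at x0) \<and> (\<forall>c v. L (c *s v) = c * L v)"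
    by blast
qed

section \<open>Homogeneous polynomials\<close>

lemma finite_multi_indices: "finite {\<alpha> :: 'n::finite \<Rightarrow> nat. (\<Sum>i\<in>UNIV. \<alpha> i) = d}"
proof (rule finite_subset)
  show "{\<alpha> :: 'n \<Rightarrow> nat. (\<Sum>i\<in>UNIV. \<alpha> i) = d} \<subseteq> PiE UNIV (\<lambda>_. {..d})"
    by (auto simp: member_le_sum)
  show "finite (PiE (UNIV :: 'n set) (\<lambda>_. {..d}))"
    by (rule finite_PiE) auto
qed

lemma homogeneous_poly_const: "homogeneous_poly 0 (\<lambda>x :: complex ^ 'n. a)"
proof -
  have "{\<alpha> :: 'n \<Rightarrow> nat. (\<Sum>i\<in>UNIV. \<alpha> i) = 0} = {\<lambda>_. 0}"
    by auto
  then show ?thesis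
    unfolding homogeneous_poly_def by (intro exI[of _ "\<lambda>_. a"]) simp
qed

lemma homogeneous_poly_zero: "homogeneous_poly d (\<lambda>x. 0)"
  unfolding homogeneous_poly_def by (intro exI[of _ "\<lambda>_. 0"]) simp

lemma homogeneous_poly_add:
  assumes "homogeneous_poly d p" "homogeneous_poly d q"
  shows "homogeneous_poly d (\<lambda>x. p x + q x)"
proof -
  from assms obtain a b where
    "p = (\<lambda>x. \<Sum>\<alpha> | (\<Sum>i\<in>UNIV. \<alpha> i) = d. a \<alpha> * (\<Prod>i\<in>UNIV. (x $ i) ^ \<alpha> i))"
    "q = (\<lambda>x. \<Sum>\<alpha> | (\<Sum>i\<in>UNIV. \<alpha> i) = d. b \<alpha> * (\<Prod>i\<in>UNIV. (x $ i) ^ \<alpha> i))"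
    unfolding homogeneous_poly_def by blast
  then show ?thesis
    unfolding homogeneous_poly_def
    by (intro exI[of _ "\<lambda>\<alpha>. a \<alpha> + b \<alpha>"]) (simp add: distrib_right sum.distrib)
qed

lemma homogeneous_poly_sum:
  assumes "\<And>k. k \<in> A \<Longrightarrow> homogeneous_poly d (p k)"
  shows "homogeneous_poly d (\<lambda>x. \<Sum>k\<in>A. p k x)"
  using assms
  by (induction A rule: infinite_finite_induct)
     (simp_all add: homogeneous_poly_zero homogeneous_poly_add)

lemma homogeneous_poly_cmult:
  assumes "homogeneous_poly d p"
  shows "homogeneous_poly d (\<lambda>x. a * p x)"
proof -
  from assms obtain c where
    "p = (\<lambda>x. \<Sum>\<alpha> | (\<Sum>i\<in>UNIV. \<alpha> i) = d. c \<alpha> * (\<Prod>i\<in>UNIV. (x $ i) ^ \<alpha> i))"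
    unfolding homogeneous_poly_def by blast
  then show ?thesis
    unfolding homogeneous_poly_def
    by (intro exI[of _ "\<lambda>\<alpha>. a * c \<alpha>"]) (simp add: sum_distrib_left mult.assoc)
qed

text \<open>Raising the \<open>k\<close>-th exponent by one maps the multi-indices of degree
  \<open>d\<close> bijectively onto those of degree \<open>Suc d\<close> with nonzero
  \<open>k\<close>-th exponent; all other coefficients of the product vanish.\<close>

lemma homogeneous_poly_mult_coordinate:
  fixes p :: "complex ^ 'n \<Rightarrow> complex"
  assumes "homogeneous_poly d p"
  shows "homogeneous_poly (Suc d) (\<lambda>x. x $ k * p x)"
proof -
  let ?I = "\<lambda>d. {\<alpha> :: 'n \<Rightarrow> nat. (\<Sum>i\<in>UNIV. \<alpha> i) = d}"
  let ?mon = "\<lambda>(x :: complex ^ 'n) \<alpha>. \<Prod>i\<in>UNIV. (x $ i) ^ \<alpha> i"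
  let ?s = "\<lambda>\<alpha>. \<alpha>(k := Suc (\<alpha> k))"
  from assms obtain c where p: "p = (\<lambda>x. \<Sum>\<alpha>\<in>?I d. c \<alpha> * ?mon x \<alpha>)"
    unfolding homogeneous_poly_def by blast
  \<comment> \<open>The case \<open>\<beta> k = 0\<close> is split off, so the truncated subtraction
    is only taken at positive exponents.\<close>
  define c' where "c' \<beta> = (if \<beta> k = 0 then 0 else c (\<beta>(k := \<beta> k - 1)))" for \<beta>
  have sum_s: "(\<Sum>i\<in>UNIV. ?s \<alpha> i) = Suc (\<Sum>i\<in>UNIV. \<alpha> i)" for \<alpha>
  proof -
    have "(\<Sum>i\<in>UNIV. ?s \<alpha> i) = ?s \<alpha> k + (\<Sum>i\<in>UNIV - {k}. ?s \<alpha> i)"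
      by (rule sum.remove) auto
    also have "(\<Sum>i\<in>UNIV - {k}. ?s \<alpha> i) = (\<Sum>i\<in>UNIV - {k}. \<alpha> i)"
      by (rule sum.cong) auto
    finally show ?thesis
      using sum.remove[of UNIV k \<alpha>] by simp
  qed
  have mon_s: "?mon x (?s \<alpha>) = x $ k * ?mon x \<alpha>" for x \<alpha>
  proof -
    have "?mon x (?s \<alpha>) = (x $ k) ^ ?s \<alpha> k * (\<Prod>i\<in>UNIV - {k}. (x $ i) ^ ?s \<alpha> i)"
      by (rule prod.remove) auto
    also have "(\<Prod>i\<in>UNIV - {k}. (x $ i) ^ ?s \<alpha> i) = (\<Prod>i\<in>UNIV - {k}. (x $ i) ^ \<alpha> i)"
      by (rule prod.cong) auto
    finally show ?thesis
      using prod.remove[of UNIV k "\<lambda>i. (x $ i) ^ \<alpha> i"] by (simp add: mult.assoc)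
  qed
  have inj: "inj_on ?s (?I d)"
  proof (rule inj_onI)
    fix \<alpha> \<beta> assume "?s \<alpha> = ?s \<beta>"
    then have "?s \<alpha> i = ?s \<beta> i" for i by (rule fun_cong)
    then show "\<alpha> = \<beta>" by (intro ext) (metis fun_upd_apply nat.inject)
  qed
  have image: "?s ` ?I d = {\<beta> \<in> ?I (Suc d). \<beta> k \<noteq> 0}"
  proof (intro equalityI subsetI)
    fix \<beta> assume \<beta>: "\<beta> \<in> {\<beta> \<in> ?I (Suc d). \<beta> k \<noteq> 0}"
    let ?\<alpha> = "\<beta>(k := \<beta> k - 1)"
    have "\<beta> = ?s ?\<alpha>" using \<beta> by auto
    moreover from this have "?\<alpha> \<in> ?I d"
      using \<beta> sum_s[of ?\<alpha>] by simp
    ultimately show "\<beta> \<in> ?s ` ?I d" by blast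
  qed (use sum_s in auto)
  have "x $ k * p x = (\<Sum>\<beta>\<in>?I (Suc d). c' \<beta> * ?mon x \<beta>)" for x
  proof -
    have "x $ k * p x = (\<Sum>\<alpha>\<in>?I d. c' (?s \<alpha>) * ?mon x (?s \<alpha>))"
      unfolding p sum_distrib_left mon_s by (intro sum.cong) (simp_all add: c'_def)
    also have "\<dots> = (\<Sum>\<beta>\<in>?s ` ?I d. c' \<beta> * ?mon x \<beta>)"
      by (simp add: sum.reindex[OF inj])
    also have "\<dots> = (\<Sum>\<beta>\<in>?I (Suc d). c' \<beta> * ?mon x \<beta>)"
      unfolding image by (rule sum.mono_neutral_left) (auto simp: finite_multi_indices c'_def)
    finally show ?thesis .
  qed
  then show ?thesis
    unfolding homogeneous_poly_def by blast
qed

lemma homogeneous_poly_scale: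
  assumes "homogeneous_poly d p"
  shows "p (t *s x) = t ^ d * p x"
proof -
  from assms obtain c where
    "p = (\<lambda>x. \<Sum>\<alpha> | (\<Sum>i\<in>UNIV. \<alpha> i) = d. c \<alpha> * (\<Prod>i\<in>UNIV. (x $ i) ^ \<alpha> i))"
    unfolding homogeneous_poly_def by blast
  then show ?thesis
    by (simp add: sum_distrib_left power_mult_distrib prod.distrib flip: power_sum)
       (auto intro!: sum.cong)
qed

lemma continuous_on_homogeneous_poly:
  assumes "homogeneous_poly d p"
  shows "continuous_on S p"
proof -
  from assms obtain c where
    "p = (\<lambda>x. \<Sum>\<alpha> | (\<Sum>i\<in>UNIV. \<alpha> i) = d. c \<alpha> * (\<Prod>i\<in>UNIV. (x $ i) ^ \<alpha> i))"
    unfolding homogeneous_poly_def by blast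
  then show ?thesis by (auto intro!: continuous_intros)
qed

text \<open>Rescale \<open>y\<close> to the sphere of radius \<open>\<rho>\<close> and use
  homogeneity. The point \<open>y = 0\<close> cannot be rescaled and is treated apart: for
  \<open>d = 0\<close> the factor is \<open>0 ^ 0 = 1\<close>, for \<open>d > 0\<close> both sides
  vanish.\<close>

lemma homogeneous_poly_bound:
  assumes p: "homogeneous_poly d p" and "\<rho> > 0" and bound: "\<And>x. norm x \<le> \<rho> \<Longrightarrow> norm (p x) \<le> M"
  shows "norm (p y) \<le> M * (norm y / \<rho>) ^ d"
proof (cases "y = 0")
  case True
  show ?thesis
  proof (cases d)
    case 0
    then show ?thesis using bound[of y] \<open>\<rho> > 0\<close> True by simp
  next
    case (Suc i)
    have "p (0 *s y) = 0 ^ d * p y"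
      by (rule homogeneous_poly_scale[OF p])
    then show ?thesis using True Suc by simp
  qed
next
  case False
  define t where "t = norm y / \<rho>"
  have t: "t > 0" using False \<open>\<rho> > 0\<close> by (simp add: t_def)
  let ?z = "complex_of_real (inverse t) *s y"
  have "norm ?z = \<rho>"
    using False \<open>\<rho> > 0\<close>
    by (simp add: norm_vector_scalar_mult_complex t_def norm_divide norm_mult norm_inverse)
  moreover have "p (of_real t *s ?z) = of_real t ^ d * p ?z"
    by (rule homogeneous_poly_scale[OF p])
  moreover have "of_real t *s ?z = y"
    using t by (simp add: vec_eq_iff)
  ultimately have "norm (p y) = t ^ d * norm (p ?z)" "norm (p ?z) \<le> M"
    using t bound[of ?z] by (simp_all add: norm_mult norm_power)
  then show ?thesis
    using t by (simp add: t_def mult.commute mult_right_mono)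
qed

section \<open>Homogeneous expansions\<close>

text \<open>On the line through \<open>x\<close> the expansion becomes a power series in
  \<open>t\<close> with coefficients \<open>F j x\<close>, and those are unique in one variable.
  This justifies the \<open>THE\<close> in \<open>homogeneous_part\<close>.\<close>

lemma homogeneous_expansion_unique:
  assumes "homogeneous_expansion f F" "homogeneous_expansion f G"
  shows "F = G"
proof (intro ext)
  fix j x
  have *: "(\<lambda>t. f (t *s x)) has_fps_expansion Abs_fps (\<lambda>j. H j x)" if "homogeneous_expansion f H" for H
  proof (rule has_fps_expansionI)
    have scale: "H j (t *s x) = t ^ j * H j x" for j t
      using that unfolding homogeneous_expansion_def by (intro homogeneous_poly_scale) blast
    have "((\<lambda>t::complex. t *s x) \<longlongrightarrow> 0) (nhds 0)"
      using linear_continuous_at[OF bounded_linear_vector_scalar_mult_left, of 0 x]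
      by (simp add: isCont_def tendsto_nhds_iff)
    then have "\<forall>\<^sub>F t in nhds 0. (\<lambda>j. H j (t *s x)) sums f (t *s x)"
      using that unfolding homogeneous_expansion_def by (auto dest: filterlim_iff[THEN iffD1])
    then show "\<forall>\<^sub>F t in nhds 0. (\<lambda>j. fps_nth (Abs_fps (\<lambda>j. H j x)) j * t ^ j) sums f (t *s x)"
      by (simp add: scale mult.commute)
  qed
  have "Abs_fps (\<lambda>j. F j x) = Abs_fps (\<lambda>j. G j x)"
    using fps_expansion_unique_complex * assms by blast
  then show "F j x = G j x"
    by (simp add: fps_eq_iff)
qed

lemma homogeneous_part_eqI:
  assumes "homogeneous_expansion f F"
  shows "homogeneous_part f = F"
  unfolding homogeneous_part_def using assms homogeneous_expansion_unique by blast

section \<open>Existence of the expansion: Taylor series on complex lines\<close>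

lemma higher_deriv_sum:
  fixes g :: "'a \<Rightarrow> complex \<Rightarrow> complex"
  assumes "\<And>k. k \<in> A \<Longrightarrow> g k holomorphic_on S" "open S" "z \<in> S"
  shows "(deriv ^^ j) (\<lambda>w. \<Sum>k\<in>A. g k w) z = (\<Sum>k\<in>A. (deriv ^^ j) (g k) z)"
  using assms(1)
proof (induction A rule: infinite_finite_induct)
  case (insert k A)
  then have "(deriv ^^ j) (\<lambda>w. g k w + (\<Sum>k\<in>A. g k w)) z
    = (deriv ^^ j) (g k) z + (deriv ^^ j) (\<lambda>w. \<Sum>k\<in>A. g k w) z"
    using assms(2,3) by (intro higher_deriv_add[of _ S]) (auto intro!: holomorphic_intros)
  then show ?case using insert by simp
qed simp_all

lemma open_line_preimage:
  fixes x :: "complex ^ 'n"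
  assumes "open U"
  shows "open {t. t *s x \<in> U}"
  using open_vimage[OF assms, of "\<lambda>t. t *s x"]
    continuous_on_vector_scalar_mult[OF continuous_on_id continuous_on_const, of UNIV x]
  by (simp add: vimage_def)

lemma complex_differentiable_on_line_deriv:
  assumes "complex_differentiable_on f U" "t *s x \<in> U"
  shows "((\<lambda>t. f (t *s x)) has_field_derivative dir_deriv x f (t *s x)) (at t)"
  using complex_differentiable_on_along_line[OF assms(1), of 0 t x] assms(2) by simp

lemma complex_differentiable_on_line_holomorphic:
  assumes "complex_differentiable_on f U" "open U"
  shows "(\<lambda>t. f (t *s x)) holomorphic_on {t. t *s x \<in> U}"
  using complex_differentiable_on_line_deriv[OF assms(1)]
  by (subst holomorphic_on_open[OF open_line_preimage[OF assms(2)]]) blast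

lemma dir_deriv_axis_expansion:
  assumes "complex_differentiable_on f U" "x \<in> U"
  shows "dir_deriv v f x = (\<Sum>k\<in>UNIV. v $ k * dir_deriv (axis k 1) f x)"
proof -
  have "linear (\<lambda>v. dir_deriv v f x)"
    using complex_differentiable_on_D(1)[OF assms] has_derivative_linear by blast
  then have "dir_deriv (\<Sum>k\<in>UNIV. v $ k *s axis k 1) f x = (\<Sum>k\<in>UNIV. dir_deriv (v $ k *s axis k 1) f x)"
    by (rule linear_sum)
  then show ?thesis
    by (simp add: basis_expansion complex_differentiable_on_D(2)[OF assms])
qed

text \<open>By the chain rule, the derivative of \<open>f (t *s x)\<close> in \<open>t\<close> is
  the sum over \<open>k\<close> of \<open>x $ k\<close> times the \<open>k\<close>-th partial
  derivative at \<open>t *s x\<close>. Induction on \<open>j\<close> applied to the partial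
  derivatives, hence with \<open>f\<close> arbitrary, raises the degree by one.\<close>

lemma homogeneous_poly_higher_deriv:
  assumes "complex_differentiable_on f U" "open U" "0 \<in> U"
  shows "homogeneous_poly j (\<lambda>x. (deriv ^^ j) (\<lambda>t. f (t *s x)) 0)"
  using assms(1)
proof (induction j arbitrary: f)
  case 0
  then show ?case by (simp add: homogeneous_poly_const)
next
  case (Suc j)
  let ?g = "\<lambda>k. dir_deriv (axis k 1) f"
  have g: "complex_differentiable_on (?g k) U" for k
    by (rule complex_differentiable_on_dir_deriv[OF Suc.prems assms(2)])
  have "(deriv ^^ Suc j) (\<lambda>t. f (t *s x)) 0 = (\<Sum>k\<in>UNIV. x $ k * (deriv ^^ j) (\<lambda>t. ?g k (t *s x)) 0)" for x
  proof -
    let ?S = "{t. t *s x \<in> U}"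
    have S: "open ?S" "0 \<in> ?S"
      using open_line_preimage[OF assms(2)] assms(3) by auto
    have hol: "(\<lambda>t. ?g k (t *s x)) holomorphic_on ?S" for k
      by (rule complex_differentiable_on_line_holomorphic[OF g assms(2)])
    \<comment> \<open>An identity at \<open>t = 0\<close> alone would not do: the remaining
      \<open>j\<close> derivatives depend on the germ at 0.\<close>
    have "\<forall>\<^sub>F t in nhds 0. deriv (\<lambda>t. f (t *s x)) t = (\<Sum>k\<in>UNIV. x $ k * ?g k (t *s x))"
      using eventually_nhds_in_open[OF S]
    proof eventually_elim
      case (elim t)
      then show ?case
        using DERIV_imp_deriv[OF complex_differentiable_on_line_deriv[OF Suc.prems]]
          dir_deriv_axis_expansion[OF Suc.prems, of "t *s x" x] by auto
    qed
    then have "(deriv ^^ Suc j) (\<lambda>t. f (t *s x)) 0 = (deriv ^^ j) (\<lambda>t. \<Sum>k\<in>UNIV. x $ k * ?g k (t *s x)) 0"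
      by (simp add: funpow_swap1 higher_deriv_cong_ev)
    also have "\<dots> = (\<Sum>k\<in>UNIV. (deriv ^^ j) (\<lambda>t. x $ k * ?g k (t *s x)) 0)"
      by (rule higher_deriv_sum[OF _ S]) (intro holomorphic_intros hol)
    also have "\<dots> = (\<Sum>k\<in>UNIV. x $ k * (deriv ^^ j) (\<lambda>t. ?g k (t *s x)) 0)"
      by (intro sum.cong refl higher_deriv_cmult[OF hol S(2,1)])
    finally show ?thesis .
  qed
  then show ?case
    by (simp only:) (intro homogeneous_poly_sum homogeneous_poly_mult_coordinate Suc.IH g)
qed

text \<open>The degree \<open>j\<close> term at \<open>x\<close> is the \<open>j\<close>-th Taylor
  coefficient of \<open>f (t *s x)\<close> at \<open>t = 0\<close>. Cauchy's inequality on the unit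
  circle in \<open>t\<close> bounds all of them by the maximum \<open>M\<close> of \<open>f\<close>
  on a closed ball.\<close>

lemma holomorphic_germ_expansion:
  assumes "holomorphic_germ f"
  obtains F \<rho> M where "homogeneous_expansion f F" "\<rho> > 0"
    "\<And>x. norm x \<le> \<rho> \<Longrightarrow> (\<lambda>j. F j x) sums f x"
    "\<And>j x. norm x \<le> \<rho> \<Longrightarrow> norm (F j x) \<le> M"
proof -
  obtain U where U: "open U" "0 \<in> U" "complex_differentiable_on f U"
    using assms unfolding holomorphic_germ_def complex_differentiable_on_def by blast
  obtain R where R: "R > 0" "cball 0 R \<subseteq> U"
    using U(1,2) open_contains_cball by blast
  have "compact (f ` cball 0 R)"
    using continuous_on_subset[OF complex_differentiable_on_imp_continuous_on[OF U(3)] R(2)]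
    by (intro compact_continuous_image) auto
  then obtain M where M: "\<And>x. norm x \<le> R \<Longrightarrow> norm (f x) \<le> M"
    using compact_imp_bounded[of "f ` cball 0 R"] unfolding bounded_iff
    by (metis imageI mem_cball_0)
  let ?h = "\<lambda>x t. f (t *s x)"
  define F where "F j x = (1 / fact j) * (deriv ^^ j) (?h x) 0" for j x
  \<comment> \<open>Halving the radius admits all \<open>t\<close> with
    \<open>norm t \<le> 2\<close>, so that \<open>t = 1\<close> is an interior point where the
    Taylor series may be evaluated.\<close>
  have in_cball: "norm (t *s x) \<le> R" if "norm x \<le> R / 2" "norm t \<le> 2" for t and x :: "complex ^ 'a"
    using mult_mono[OF that(2,1)] by (simp add: norm_vector_scalar_mult_complex)
  have hol: "?h x holomorphic_on cball 0 2" if "norm x \<le> R / 2" for x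
    using R(2) in_cball[OF that]
    by (intro holomorphic_on_subset[OF complex_differentiable_on_line_holomorphic[OF U(3,1)]]) auto
  have sums: "(\<lambda>j. F j x) sums f x" if "norm x \<le> R / 2" for x
    using holomorphic_power_series[OF holomorphic_on_subset[OF hol[OF that] ball_subset_cball], of 1]
    by (simp add: F_def)
  have bound: "norm (F j x) \<le> M" if "norm x \<le> R / 2" for j x
  proof -
    have "norm ((deriv ^^ j) (?h x) 0) \<le> fact j * M / 1 ^ j"
    proof (rule Cauchy_inequality)
      show "?h x holomorphic_on ball 0 1"
        by (rule holomorphic_on_subset[OF hol[OF that]]) auto
      show "continuous_on (cball 0 1) (?h x)"
        by (rule holomorphic_on_imp_continuous_on, rule holomorphic_on_subset[OF hol[OF that]]) auto
      show "norm (?h x t) \<le> M" if t: "norm (0 - t) = 1" for t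
        using t by (intro M in_cball \<open>norm x \<le> R / 2\<close>) simp
    qed simp
    then show ?thesis
      by (simp add: F_def norm_divide field_simps)
  qed
  have "\<forall>\<^sub>F x :: complex ^ 'a in nhds 0. x \<in> ball 0 (R/2)"
    using R(1) by (intro eventually_nhds_in_open) auto
  then have "\<forall>\<^sub>F x in nhds 0. (\<lambda>j. F j x) sums f x"
    by eventually_elim (rule sums, simp)
  moreover have "homogeneous_poly j (F j)" for j
    unfolding F_def by (rule homogeneous_poly_cmult[OF homogeneous_poly_higher_deriv[OF U(3,1,2)]])
  ultimately have "homogeneous_expansion f F"
    unfolding homogeneous_expansion_def by blast
  then show ?thesis
    using that[of F "R / 2" M] R(1) sums bound by simp
qed

section \<open>Order and initial form of a holomorphic germ\<close>

lemma homogeneous_poly_initial_form: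
  assumes "holomorphic_germ f"
  shows "homogeneous_poly (ord_0 f) (initial_form f)"
proof -
  obtain F where "homogeneous_expansion f F"
    using holomorphic_germ_expansion[OF assms] .
  then show ?thesis
    unfolding initial_form_def by (simp add: homogeneous_part_eqI homogeneous_expansion_def)
qed

lemma initial_form_nonzero:
  assumes "holomorphic_germ f" "\<not> (\<forall>\<^sub>F x in nhds 0. f x = 0)"
  obtains x where "initial_form f x \<noteq> 0"
proof -
  obtain F where F: "homogeneous_expansion f F"
    using holomorphic_germ_expansion[OF assms(1)] .
  have "\<exists>j. F j \<noteq> (\<lambda>x. 0)"
  proof (rule ccontr)
    assume "\<not> ?thesis"
    then have "\<forall>\<^sub>F x in nhds 0. (\<lambda>j. 0) sums f x"
      using F by (simp add: homogeneous_expansion_def)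
    then have "\<forall>\<^sub>F x in nhds 0. f x = 0"
      by eventually_elim (simp add: sums_iff)
    then show False using assms(2) by blast
  qed
  then have "homogeneous_part f (ord_0 f) \<noteq> (\<lambda>x. 0)"
    unfolding ord_0_def homogeneous_part_eqI[OF F] by (rule LeastI_ex[of "\<lambda>j. F j \<noteq> (\<lambda>x. 0)"])
  then show ?thesis
    using that unfolding initial_form_def by blast
qed

text \<open>Terms of degree below the order vanish by minimality, and those above it are bounded by
  \<open>M * (norm y / \<rho>) ^ j\<close>. On half the radius this tail is dominated by a geometric
  series of ratio 1/2, whence the factor 2.\<close>

lemma initial_form_remainder:
  assumes "holomorphic_germ f"
  obtains C \<rho> where "\<rho> > 0" "C \<ge> 0"
    "\<And>y. norm y \<le> \<rho> \<Longrightarrow> norm (f y - initial_form f y) \<le> C * norm y ^ Suc (ord_0 f)"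
proof -
  obtain F \<rho> M where F: "homogeneous_expansion f F" "\<rho> > 0"
    "\<And>x. norm x \<le> \<rho> \<Longrightarrow> (\<lambda>j. F j x) sums f x"
    "\<And>j x. norm x \<le> \<rho> \<Longrightarrow> norm (F j x) \<le> M"
    using holomorphic_germ_expansion[OF assms] by blast
  define m where "m = ord_0 f"
  have part: "homogeneous_part f = F" by (rule homogeneous_part_eqI[OF F(1)])
  have M: "M \<ge> 0" using order_trans[OF norm_ge_zero F(4)[of 0 0]] F(2) by simp
  have low: "F j y = 0" if "j < m" for j y
    using not_less_Least[of j "\<lambda>j. F j \<noteq> (\<lambda>x. 0)"] that by (auto simp: m_def ord_0_def part)
  have Fj: "norm (F j y) \<le> M * (norm y / \<rho>) ^ j" for j y
    using F(1) by (intro homogeneous_poly_bound F) (simp add: homogeneous_expansion_def)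
  have "norm (f y - F m y) \<le> 2 * M / \<rho> ^ Suc m * norm y ^ Suc m" if y: "norm y \<le> \<rho> / 2" for y
  proof -
    have "(\<lambda>j. F j y) sums f y" using F(2,3) y by simp
    then have "(\<lambda>j. F (j + Suc m) y) sums (f y - (\<Sum>j<Suc m. F j y))"
      by (subst sums_iff_shift) simp
    moreover have "(\<Sum>j<Suc m. F j y) = F m y" using low by simp
    ultimately have s: "(\<lambda>j. F (j + Suc m) y) sums (f y - F m y)" by simp
    let ?B = "M * (norm y / \<rho>) ^ Suc m"
    have "(\<lambda>j. ?B * (1/2) ^ j) sums (?B * (1 / (1 - 1/2)))"
      by (intro sums_mult geometric_sums) simp
    moreover have "norm (F (j + Suc m) y) \<le> ?B * (1/2) ^ j" for j
    proof -
      have "(norm y / \<rho>) ^ j \<le> (1/2) ^ j"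
        using y F(2) by (intro power_mono) (auto simp: field_simps)
      then have "?B * (norm y / \<rho>) ^ j \<le> ?B * (1/2) ^ j"
        using M F(2) by (intro mult_left_mono) auto
      then show ?thesis
        using Fj[of "j + Suc m" y] by (simp add: power_add mult.assoc mult.left_commute mult.commute)
    qed
    ultimately have "norm (f y - F m y) \<le> ?B * (1 / (1 - 1/2))"
      using norm_suminf_le[of "\<lambda>j. F (j + Suc m) y" "\<lambda>j. ?B * (1/2) ^ j"] s by (simp add: sums_iff)
    then show ?thesis by (simp add: power_divide mult_ac)
  qed
  then show ?thesis
    using that[of "\<rho> / 2" "2 * M / \<rho> ^ Suc m"] F(2) M
    unfolding initial_form_def part m_def[symmetric] by simp
qed

text \<open>The remainder estimate at \<open>y = 0\<close> shows that the initial form agrees with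
  \<open>f\<close> at 0, so it vanishes there; in degree 0 it would be constant, hence zero.
  Positivity later yields \<open>t ^ m\<close> tending to 0 and the existence of \<open>m\<close>-th
  roots.\<close>

lemma ord_0_pos:
  assumes "holomorphic_germ f" "f 0 = 0" "\<not> (\<forall>\<^sub>F x in nhds 0. f x = 0)"
  shows "ord_0 f > 0"
proof (rule ccontr)
  assume "\<not> ?thesis"
  then have 0: "ord_0 f = 0" by simp
  obtain x where x: "initial_form f x \<noteq> 0"
    using initial_form_nonzero[OF assms(1,3)] .
  obtain C \<rho> where "\<rho> > 0"
    "\<And>y. norm y \<le> \<rho> \<Longrightarrow> norm (f y - initial_form f y) \<le> C * norm y ^ Suc (ord_0 f)"
    using initial_form_remainder[OF assms(1)] by blast
  from this(1) this(2)[of 0] have "initial_form f 0 = 0"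
    using assms(2) by simp
  moreover have "initial_form f (0 *s x) = 0 ^ 0 * initial_form f x"
    using homogeneous_poly_scale[OF homogeneous_poly_initial_form[OF assms(1)]] 0 by metis
  ultimately show False using x by simp
qed

lemma scaleR_vec_conv_vector_scalar_mult: "t *\<^sub>R (x :: complex ^ 'n) = complex_of_real t *s x"
  by (simp add: vec_eq_iff scaleR_conv_of_real[where 'a = complex])

lemma holomorphic_germ_growth:
  assumes "holomorphic_germ f"
  obtains A where "A \<ge> 0" "\<forall>\<^sub>F y in nhds 0. norm (f y) \<le> A * norm y ^ ord_0 f"
proof -
  let ?p = "initial_form f" and ?m = "ord_0 f"
  note p = homogeneous_poly_initial_form[OF assms]
  obtain C \<rho> where C: "\<rho> > 0" "C \<ge> 0"
    "\<And>y. norm y \<le> \<rho> \<Longrightarrow> norm (f y - ?p y) \<le> C * norm y ^ Suc ?m"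
    using initial_form_remainder[OF assms] by blast
  have "compact (?p ` cball 0 1)"
    by (intro compact_continuous_image continuous_on_homogeneous_poly[OF p]) auto
  then obtain M where M: "\<And>x. norm x \<le> 1 \<Longrightarrow> norm (?p x) \<le> M"
    using compact_imp_bounded[of "?p ` cball 0 1"] unfolding bounded_iff
    by (metis imageI mem_cball_0)
  have "M \<ge> 0" using order_trans[OF norm_ge_zero M[of 0]] by simp
  have "norm (f y) \<le> (C + M) * norm y ^ ?m" if "y \<in> ball 0 (min \<rho> 1)" for y
  proof -
    have y: "norm y \<le> \<rho>" "norm y \<le> 1" using that by auto
    have "norm (f y) \<le> norm (f y - ?p y) + norm (?p y)"
      using norm_triangle_sub[of "f y" "?p y"] by simp
    also have "norm (f y - ?p y) \<le> C * norm y ^ Suc ?m" by (rule C(3)[OF y(1)])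
    also have "\<dots> \<le> C * norm y ^ ?m"
      using y C(2) by (intro mult_left_mono power_decreasing) auto
    also have "norm (?p y) \<le> M * norm y ^ ?m"
      using homogeneous_poly_bound[OF p zero_less_one M] by simp
    finally show ?thesis by (simp add: algebra_simps)
  qed
  moreover have "\<forall>\<^sub>F y :: complex ^ 'a in nhds 0. y \<in> ball 0 (min \<rho> 1)"
    using C(1) by (intro eventually_nhds_in_open) auto
  ultimately have "\<forall>\<^sub>F y in nhds 0. norm (f y) \<le> (C + M) * norm y ^ ?m"
    by (auto elim: eventually_mono)
  then show ?thesis using that[of "C + M"] C(2) \<open>M \<ge> 0\<close> by simp
qed

text \<open>Homogeneity cancels \<open>t n ^ ord_0 f\<close> exactly, and the remainder is of one
  order higher, so it leaves a factor \<open>t n\<close>. The points \<open>x n\<close> may move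
  because \<open>g\<close> will be evaluated at rescaled values of \<open>\<phi>\<close>, which
  merely converge.\<close>

lemma initial_form_blow_up:
  assumes f: "holomorphic_germ f"
    and t: "\<And>n. t n > 0" "t \<longlonglongrightarrow> 0" and x: "x \<longlonglongrightarrow> x0"
  shows "(\<lambda>n. f (t n *\<^sub>R x n) /\<^sub>R t n ^ ord_0 f) \<longlonglongrightarrow> initial_form f x0"
proof -
  let ?p = "initial_form f" and ?m = "ord_0 f"
  note p = homogeneous_poly_initial_form[OF f]
  obtain C \<rho> where C: "\<rho> > 0"
    "\<And>y. norm y \<le> \<rho> \<Longrightarrow> norm (f y - ?p y) \<le> C * norm y ^ Suc ?m"
    using initial_form_remainder[OF f] by blast
  have lim0: "(\<lambda>n. t n *\<^sub>R x n) \<longlonglongrightarrow> 0"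
    using tendsto_scaleR[OF t(2) x] by simp
  have ev: "\<forall>\<^sub>F n in sequentially. norm (t n *\<^sub>R x n) < \<rho>"
    using order_tendstoD(2)[OF tendsto_norm[OF lim0]] C(1) by simp
  have "\<forall>\<^sub>F n in sequentially.
      norm (f (t n *\<^sub>R x n) /\<^sub>R t n ^ ?m - ?p (x n)) \<le> C * t n * norm (x n) ^ Suc ?m"
    using ev
  proof eventually_elim
    case (elim n)
    have "?p (t n *\<^sub>R x n) = t n ^ ?m *\<^sub>R ?p (x n)"
      using homogeneous_poly_scale[OF p]
      by (simp add: scaleR_vec_conv_vector_scalar_mult scaleR_conv_of_real[where 'a = complex])
    then have "f (t n *\<^sub>R x n) /\<^sub>R t n ^ ?m - ?p (x n) = (f (t n *\<^sub>R x n) - ?p (t n *\<^sub>R x n)) /\<^sub>R t n ^ ?m"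
      using t(1)[of n] by (simp add: scaleR_right_diff_distrib)
    then have "norm (f (t n *\<^sub>R x n) /\<^sub>R t n ^ ?m - ?p (x n)) = norm (f (t n *\<^sub>R x n) - ?p (t n *\<^sub>R x n)) / t n ^ ?m"
      using t(1)[of n] by (simp add: divide_inverse mult.commute)
    also have "\<dots> \<le> C * norm (t n *\<^sub>R x n) ^ Suc ?m / t n ^ ?m"
      using C(2)[of "t n *\<^sub>R x n"] elim t(1)[of n] by (intro divide_right_mono) auto
    also have "\<dots> = C * t n * norm (x n) ^ Suc ?m"
      using t(1)[of n] by (simp add: power_mult_distrib field_simps)
    finally show ?case .
  qed
  moreover have "(\<lambda>n. C * t n * norm (x n) ^ Suc ?m) \<longlonglongrightarrow> C * 0 * norm x0 ^ Suc ?m"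
    by (intro tendsto_intros t x)
  ultimately have "(\<lambda>n. f (t n *\<^sub>R x n) /\<^sub>R t n ^ ?m - ?p (x n)) \<longlonglongrightarrow> 0"
    using Lim_null_comparison by simp
  moreover have "(\<lambda>n. ?p (x n)) \<longlonglongrightarrow> ?p x0"
    using continuous_on_homogeneous_poly[OF p, of UNIV] x
    by (intro continuous_on_tendsto_compose[of UNIV ?p]) auto
  ultimately show ?thesis
    by (rule Lim_transform[rotated])
qed

section \<open>Blow-ups of bi-Lipschitz germs\<close>

text \<open>Precompose with the nearest-point projection onto a closed ball inside \<open>U\<close>,
  which is 1-Lipschitz. With a global map every rescaling is defined on the whole space.\<close>

lemma lipschitz_germ_extension:
  fixes \<phi> :: "'a::euclidean_space \<Rightarrow> 'b::metric_space"
  assumes "C-lipschitz_on U \<phi>" "open U" "0 \<in> U"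
  obtains \<phi>' where "C-lipschitz_on UNIV \<phi>'" "\<phi>' 0 = \<phi> 0" "\<forall>\<^sub>F x in nhds 0. \<phi>' x = \<phi> x"
proof -
  obtain d where d: "d > 0" "cball 0 d \<subseteq> U"
    using assms(2,3) open_contains_cball by blast
  let ?c = "closest_point (cball 0 d) :: 'a \<Rightarrow> 'a"
  have c: "?c x \<in> U" for x
    using closest_point_in_set[of "cball 0 d" x] d by auto
  have "C-lipschitz_on UNIV (\<phi> \<circ> ?c)"
  proof (rule lipschitz_onI)
    show "C \<ge> 0" using assms(1) by (rule lipschitz_on_nonneg)
    fix x y
    have "dist (\<phi> (?c x)) (\<phi> (?c y)) \<le> C * dist (?c x) (?c y)"
      by (rule lipschitz_onD[OF assms(1) c c])
    also have "\<dots> \<le> C * dist x y"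
      using \<open>C \<ge> 0\<close> d(1) by (intro mult_left_mono closest_point_lipschitz) auto
    finally show "dist ((\<phi> \<circ> ?c) x) ((\<phi> \<circ> ?c) y) \<le> C * dist x y" by simp
  qed
  moreover have "\<forall>\<^sub>F x in nhds 0. (\<phi> \<circ> ?c) x = \<phi> x"
    using eventually_nhds_in_open[of "ball 0 d" 0] d(1)
    by (auto elim!: eventually_mono simp: closest_point_self)
  ultimately show ?thesis
    using that[of "\<phi> \<circ> ?c"] d(1) by (simp add: closest_point_self)
qed

lemma lipschitz_on_filterlim_nhds_0:
  fixes h :: "'a::real_normed_vector \<Rightarrow> 'b::real_normed_vector"
  assumes "L-lipschitz_on UNIV h" "h 0 = 0"
  shows "filterlim h (nhds 0) (nhds 0)"
proof -
  have "isCont h 0"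
    using lipschitz_on_continuous_on[OF assms(1)] by (simp add: continuous_on_eq_continuous_at)
  then show ?thesis
    using assms(2) by (simp add: isCont_def tendsto_nhds_iff)
qed

text \<open>The map and its inverse are extended separately, so they remain mutually inverse near 0
  only; a blow-up at 0 sees no more than that.\<close>

lemma bilipschitz_homeo_germ_extension:
  fixes \<phi> :: "'a::euclidean_space \<Rightarrow> 'a"
  assumes "bilipschitz_homeo_germ \<phi>"
  obtains C \<phi>' \<psi>' where "C-lipschitz_on UNIV \<phi>'" "C-lipschitz_on UNIV \<psi>'" "\<phi>' 0 = 0" "\<psi>' 0 = 0"
    "\<forall>\<^sub>F x in nhds 0. \<phi>' x = \<phi> x"
    "\<forall>\<^sub>F x in nhds 0. \<psi>' (\<phi>' x) = x" "\<forall>\<^sub>F x in nhds 0. \<phi>' (\<psi>' x) = x"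
proof -
  obtain U V \<psi> C D where *: "open U" "0 \<in> U" "open V" "0 \<in> V" "homeomorphism U V \<phi> \<psi>"
      "C-lipschitz_on U \<phi>" "D-lipschitz_on V \<psi>" "\<phi> 0 = 0"
    using assms unfolding bilipschitz_homeo_germ_def by blast
  have "\<psi> 0 = 0"
    using homeomorphism_apply1[OF *(5,2)] *(8) by simp
  obtain \<phi>' where \<phi>': "C-lipschitz_on UNIV \<phi>'" "\<phi>' 0 = \<phi> 0" "\<forall>\<^sub>F x in nhds 0. \<phi>' x = \<phi> x"
    using lipschitz_germ_extension[OF *(6,1,2)] .
  obtain \<psi>' where \<psi>': "D-lipschitz_on UNIV \<psi>'" "\<psi>' 0 = \<psi> 0" "\<forall>\<^sub>F x in nhds 0. \<psi>' x = \<psi> x"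
    using lipschitz_germ_extension[OF *(7,3,4)] .
  have inverse: "\<forall>\<^sub>F x in nhds 0. b' (a' x) = x"
    if "\<forall>\<^sub>F x in nhds 0. a' x = a x" "\<forall>\<^sub>F x in nhds 0. b' x = b x"
      "L-lipschitz_on UNIV a'" "a' 0 = 0" "open W" "0 \<in> W" "\<And>x. x \<in> W \<Longrightarrow> b (a x) = x"
    for a b a' b' :: "'a \<Rightarrow> 'a" and L W
  proof -
    have "\<forall>\<^sub>F x in nhds 0. b' (a' x) = b (a' x)"
      by (rule eventually_compose_filterlim[OF that(2) lipschitz_on_filterlim_nhds_0[OF that(3,4)]])
    then show ?thesis
      using that(1) eventually_nhds_in_open[OF that(5,6)] by eventually_elim (simp add: that(7))
  qed
  show ?thesis
  proof (rule that)
    show "(max C D)-lipschitz_on UNIV \<phi>'" "(max C D)-lipschitz_on UNIV \<psi>'"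
      using lipschitz_on_mono[OF \<phi>'(1)] lipschitz_on_mono[OF \<psi>'(1)] by auto
    show "\<forall>\<^sub>F x in nhds 0. \<psi>' (\<phi>' x) = x"
      using homeomorphism_apply1[OF *(5)]
      by (intro inverse[OF \<phi>'(3) \<psi>'(3) \<phi>'(1) _ *(1,2)]) (simp_all add: \<phi>'(2) *(8))
    show "\<forall>\<^sub>F x in nhds 0. \<phi>' (\<psi>' x) = x"
      using homeomorphism_apply2[OF *(5)]
      by (intro inverse[OF \<psi>'(3) \<phi>'(3) \<psi>'(1) _ *(3,4)]) (simp_all add: \<psi>'(2) \<open>\<psi> 0 = 0\<close>)
  qed (use \<phi>' \<psi>' *(8) \<open>\<psi> 0 = 0\<close> in auto)
qed

text \<open>An Arzela-Ascoli argument: a diagonal subsequence converges on a countable dense set,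
  and the common Lipschitz constant carries this to all points. The product filter expresses
  convergence at moving points, which is what limits of compositions require.\<close>

lemma lipschitz_convergent_subsequence:
  fixes G :: "nat \<Rightarrow> 'a::euclidean_space \<Rightarrow> 'b::euclidean_space"
  assumes lip: "\<And>n. L-lipschitz_on UNIV (G n)" and G0: "\<And>n. G n 0 = 0"
  obtains r H where "strict_mono (r :: nat \<Rightarrow> nat)" "L-lipschitz_on UNIV H"
    "\<forall>x. ((\<lambda>(n, y). G (r n) y) \<longlongrightarrow> H x) (sequentially \<times>\<^sub>F nhds x)"
proof -
  have L: "L \<ge> 0" using lip lipschitz_on_nonneg by blast
  obtain D :: "'a set" where D: "countable D" "\<And>X. open X \<Longrightarrow> X \<noteq> {} \<Longrightarrow> \<exists>d\<in>D. d \<in> X"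
    using countable_dense_exists by blast
  \<comment> \<open>The diagonal lemma wants one bound for all points, but \<open>G n x\<close> is
    only bounded by \<open>L * norm x\<close>. The weight \<open>1 + norm x\<close> repairs this and
    is removed again in \<open>convD\<close>.\<close>
  have bound: "norm (G n x /\<^sub>R (1 + norm x)) \<le> L" for n x
  proof -
    have "norm (G n x) \<le> L * norm x"
      using lipschitz_onD[OF lip[of n], of x 0] G0 by simp
    also have "\<dots> \<le> L * (1 + norm x)"
      using L by (intro mult_left_mono) auto
    finally have "norm (G n x) \<le> L * (1 + norm x)" .
    then have "norm (G n x) / (1 + norm x) \<le> L"
      by (simp add: pos_divide_le_eq add_pos_nonneg)
    then show ?thesis by (simp add: divide_inverse mult.commute)
  qed
  obtain r where r: "strict_mono (r :: nat \<Rightarrow> nat)"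
    "\<And>x. x \<in> D \<Longrightarrow> \<exists>l. (\<lambda>n. G (r n) x /\<^sub>R (1 + norm x)) \<longlonglongrightarrow> l"
    using function_convergent_subsequence[OF D(1), of "\<lambda>n x. G n x /\<^sub>R (1 + norm x)" L] bound by blast
  have convD: "convergent (\<lambda>n. G (r n) x)" if x: "x \<in> D" for x
  proof -
    obtain l where "(\<lambda>n. G (r n) x /\<^sub>R (1 + norm x)) \<longlonglongrightarrow> l"
      using r(2)[OF x] by blast
    from tendsto_scaleR[OF tendsto_const[of "1 + norm x"] this]
    have "(\<lambda>n. G (r n) x) \<longlonglongrightarrow> (1 + norm x) *\<^sub>R l"
      using norm_ge_zero[of x] by (simp add: add_nonneg_eq_0_iff)
    then show ?thesis by (auto simp: convergent_def)
  qed
  have conv: "convergent (\<lambda>n. G (r n) x)" for x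
  proof -
    have "Cauchy (\<lambda>n. G (r n) x)"
    proof (rule metric_CauchyI)
      fix e :: real assume e: "e > 0"
      \<comment> \<open>Replacing \<open>x\<close> by \<open>d\<close> costs at most
        \<open>e / 3\<close> for every \<open>n\<close>; \<open>L + 1\<close> avoids division by
        zero.\<close>
      obtain d where d: "d \<in> D" "d \<in> ball x (e / (3 * (L + 1)))"
        using D(2)[of "ball x (e / (3 * (L + 1)))"] e L centre_in_ball[of x "e / (3 * (L + 1))"] by fastforce
      have "L * dist x d \<le> (L + 1) * (e / (3 * (L + 1)))"
        using d(2) L by (intro mult_mono) auto
      also have "\<dots> = e / 3"
        using L by (simp add: field_simps)
      finally have Ld: "L * dist x d \<le> e / 3" .
      have close: "dist (G n x) (G n d) \<le> e / 3" for n
        using lipschitz_onD[OF lip[of n], of x d] Ld by simp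
      have "Cauchy (\<lambda>n. G (r n) d)"
        using convD[OF d(1)] by (rule convergent_Cauchy)
      then obtain M where M: "\<And>m n. m \<ge> M \<Longrightarrow> n \<ge> M \<Longrightarrow> dist (G (r m) d) (G (r n) d) < e / 3"
        using e metric_CauchyD[of "\<lambda>n. G (r n) d" "e / 3"] by auto
      show "\<exists>M. \<forall>m\<ge>M. \<forall>n\<ge>M. dist (G (r m) x) (G (r n) x) < e"
      proof (intro exI allI impI)
        fix m n assume "m \<ge> M" "n \<ge> M"
        then show "dist (G (r m) x) (G (r n) x) < e"
          using M[of m n] close[of "r m"] close[of "r n"]
            dist_triangle[of "G (r m) x" "G (r n) x" "G (r m) d"]
            dist_triangle[of "G (r m) d" "G (r n) x" "G (r n) d"]
          by (simp add: dist_commute)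
      qed
    qed
    then show ?thesis by (rule Cauchy_convergent)
  qed
  define H where "H x = lim (\<lambda>n. G (r n) x)" for x
  have H: "(\<lambda>n. G (r n) x) \<longlonglongrightarrow> H x" for x
    using conv by (simp add: H_def convergent_LIMSEQ_iff)
  show ?thesis
  proof (rule that[OF r(1)])
    show "L-lipschitz_on UNIV H"
    proof (rule lipschitz_onI[OF _ L])
      fix x y
      show "dist (H x) (H y) \<le> L * dist x y"
        using lipschitz_onD[OF lip] by (intro LIMSEQ_le_const2[OF tendsto_dist[OF H H]]) auto
    qed
    show "\<forall>x. ((\<lambda>(n, y). G (r n) y) \<longlongrightarrow> H x) (sequentially \<times>\<^sub>F nhds x)"
    proof
      fix x :: 'a
      let ?F = "sequentially \<times>\<^sub>F nhds x"
      \<comment> \<open>Split the value at \<open>y\<close> into the value at \<open>x\<close>,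
        which converges, and a difference of norm at most \<open>L * dist y x\<close> for every
        \<open>n\<close>.\<close>
      have 1: "((\<lambda>p. G (r (fst p)) x) \<longlongrightarrow> H x) ?F"
        by (rule filterlim_compose[OF H filterlim_fst])
      have "((\<lambda>p. L * dist (snd p) x) \<longlongrightarrow> L * dist x x) ?F"
        by (intro tendsto_mult tendsto_dist tendsto_const filterlim_snd)
      then have "((\<lambda>p. L * dist (snd p) x) \<longlongrightarrow> 0) ?F" by simp
      moreover have "norm (G (r (fst p)) (snd p) - G (r (fst p)) x) \<le> L * dist (snd p) x" for p
        using lipschitz_onD[OF lip, of "snd p" x] by (simp add: dist_norm)
      ultimately have "((\<lambda>p. G (r (fst p)) (snd p) - G (r (fst p)) x) \<longlongrightarrow> 0) ?F"
        using Lim_null_comparison[of "\<lambda>p. G (r (fst p)) (snd p) - G (r (fst p)) x" "\<lambda>p. L * dist (snd p) x" ?F]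
        by simp
      from tendsto_add[OF this 1] show "((\<lambda>(n, y). G (r n) y) \<longlongrightarrow> H x) ?F"
        by (simp add: case_prod_unfold)
    qed
  qed
qed

lemma dist_scaleR_right: "dist (a *\<^sub>R v) (a *\<^sub>R w) = \<bar>a\<bar> * dist v (w :: 'a::real_normed_vector)"
  by (simp add: dist_norm flip: scaleR_right_diff_distrib)

text \<open>Conjugating by a dilation preserves the Lipschitz constant, so all rescalings form one
  equi-Lipschitz family fixing 0.\<close>

lemma lipschitz_blow_up:
  fixes \<phi> :: "'a::euclidean_space \<Rightarrow> 'b::euclidean_space"
  assumes lip: "C-lipschitz_on UNIV \<phi>" and "\<phi> 0 = 0" and t: "\<And>n. t n > 0"
  obtains r \<phi>0 where "strict_mono (r :: nat \<Rightarrow> nat)" "C-lipschitz_on UNIV \<phi>0"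
    "\<forall>x. ((\<lambda>(n, y). \<phi> (t (r n) *\<^sub>R y) /\<^sub>R t (r n)) \<longlongrightarrow> \<phi>0 x) (sequentially \<times>\<^sub>F nhds x)"
proof -
  have lip': "C-lipschitz_on UNIV (\<lambda>x. \<phi> (t n *\<^sub>R x) /\<^sub>R t n)" for n
  proof (rule lipschitz_onI)
    show "C \<ge> 0" using lip by (rule lipschitz_on_nonneg)
    fix x y
    have "dist (\<phi> (t n *\<^sub>R x)) (\<phi> (t n *\<^sub>R y)) \<le> C * dist (t n *\<^sub>R x) (t n *\<^sub>R y)"
      by (rule lipschitz_onD[OF lip]) auto
    then show "dist (\<phi> (t n *\<^sub>R x) /\<^sub>R t n) (\<phi> (t n *\<^sub>R y) /\<^sub>R t n) \<le> C * dist x y"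
      using t[of n] unfolding dist_scaleR_right by (simp add: field_simps)
  qed
  have "\<phi> (t n *\<^sub>R 0) /\<^sub>R t n = 0" for n
    using \<open>\<phi> 0 = 0\<close> by simp
  from lipschitz_convergent_subsequence[of C "\<lambda>n x. \<phi> (t n *\<^sub>R x) /\<^sub>R t n", OF lip' this]
  show ?thesis using that .
qed

text \<open>The map and its inverse are blown up along a common subsequence. As the scale tends to
  0, the identities valid near 0 hold at every fixed point eventually, so the two limits are
  globally inverse to each other.\<close>

lemma bilipschitz_homeo_germ_blow_up:
  fixes \<phi> :: "'a::euclidean_space \<Rightarrow> 'a"
  assumes "bilipschitz_homeo_germ \<phi>" and t: "\<And>n. t n > 0" "t \<longlonglongrightarrow> 0"
  obtains r \<phi>0 \<psi>0 where "strict_mono (r :: nat \<Rightarrow> nat)" "homeomorphism UNIV UNIV \<phi>0 \<psi>0" "\<phi>0 0 = 0"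
    "\<forall>x. ((\<lambda>(n, y). \<phi> (t (r n) *\<^sub>R y) /\<^sub>R t (r n)) \<longlongrightarrow> \<phi>0 x) (sequentially \<times>\<^sub>F nhds x)"
proof -
  obtain C \<phi>' \<psi>' where *: "C-lipschitz_on UNIV \<phi>'" "C-lipschitz_on UNIV \<psi>'" "\<phi>' 0 = 0" "\<psi>' 0 = 0"
    "\<forall>\<^sub>F x in nhds 0. \<phi>' x = \<phi> x"
    "\<forall>\<^sub>F x in nhds 0. \<psi>' (\<phi>' x) = x" "\<forall>\<^sub>F x in nhds 0. \<phi>' (\<psi>' x) = x"
    using bilipschitz_homeo_germ_extension[OF assms(1)] .
  obtain r1 \<phi>0 where r1: "strict_mono (r1 :: nat \<Rightarrow> nat)" "C-lipschitz_on UNIV \<phi>0"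
    "\<forall>x. ((\<lambda>(n, y). \<phi>' (t (r1 n) *\<^sub>R y) /\<^sub>R t (r1 n)) \<longlongrightarrow> \<phi>0 x) (sequentially \<times>\<^sub>F nhds x)"
    using lipschitz_blow_up[where t = t, OF *(1,3) t(1)] .
  \<comment> \<open>The second extraction refines the first, so both families converge at the scales
    \<open>s n\<close> below.\<close>
  obtain r2 \<psi>0 where r2: "strict_mono (r2 :: nat \<Rightarrow> nat)" "C-lipschitz_on UNIV \<psi>0"
    "\<forall>x. ((\<lambda>(n, y). \<psi>' (t (r1 (r2 n)) *\<^sub>R y) /\<^sub>R t (r1 (r2 n))) \<longlongrightarrow> \<psi>0 x) (sequentially \<times>\<^sub>F nhds x)"
    using lipschitz_blow_up[where t = "\<lambda>n. t (r1 n)", OF *(2,4) t(1)] .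
  define s where "s n = t (r1 (r2 n))" for n
  have r: "strict_mono (r1 \<circ> r2)"
    using r1(1) r2(1) by (rule strict_mono_o)
  have s: "s n > 0" for n using t(1) by (simp add: s_def)
  have s0: "s \<longlonglongrightarrow> 0"
    using LIMSEQ_subseq_LIMSEQ[OF t(2) r] by (simp add: s_def[abs_def] o_def)
  have "filterlim (\<lambda>(n, y). (r2 n, y)) (sequentially \<times>\<^sub>F nhds x) (sequentially \<times>\<^sub>F nhds x)" for x :: 'a
    unfolding case_prod_unfold
    by (rule filterlim_Pair[OF filterlim_compose[OF filterlim_subseq[OF r2(1)] filterlim_fst] filterlim_snd])
  from filterlim_compose[OF r1(3)[rule_format] this]
  have \<phi>0: "((\<lambda>(n, y). \<phi>' (s n *\<^sub>R y) /\<^sub>R s n) \<longlongrightarrow> \<phi>0 x) (sequentially \<times>\<^sub>F nhds x)" for x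
    by (simp add: s_def case_prod_unfold)
  have \<psi>0: "((\<lambda>(n, y). \<psi>' (s n *\<^sub>R y) /\<^sub>R s n) \<longlongrightarrow> \<psi>0 x) (sequentially \<times>\<^sub>F nhds x)" for x
    using r2(3)[rule_format, of x] by (simp add: s_def)
  have lim0: "filterlim (\<lambda>(n, y). s n *\<^sub>R y) (nhds 0) (sequentially \<times>\<^sub>F nhds x)" for x :: 'a
    using tendsto_scaleR[OF filterlim_compose[OF s0 filterlim_fst] filterlim_snd]
    by (simp add: case_prod_unfold)
  have inverse: "b0 (a0 x) = x"
    if ba: "\<forall>\<^sub>F x in nhds 0. b (a x) = x"
      and a0: "\<And>x. ((\<lambda>(n, y). a (s n *\<^sub>R y) /\<^sub>R s n) \<longlongrightarrow> a0 x) (sequentially \<times>\<^sub>F nhds x)"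
      and b0: "\<And>x. ((\<lambda>(n, y). b (s n *\<^sub>R y) /\<^sub>R s n) \<longlongrightarrow> b0 x) (sequentially \<times>\<^sub>F nhds x)"
    for a b a0 b0 :: "'a \<Rightarrow> 'a" and x
  proof -
    let ?a = "\<lambda>n. a (s n *\<^sub>R x) /\<^sub>R s n"
    have const: "filterlim (\<lambda>n. (n, x)) (sequentially \<times>\<^sub>F nhds x) sequentially"
      by (intro filterlim_Pair filterlim_ident tendsto_const)
    have "?a \<longlonglongrightarrow> a0 x"
      using filterlim_compose[OF a0 const] by simp
    then have "filterlim (\<lambda>n. (n, ?a n)) (sequentially \<times>\<^sub>F nhds (a0 x)) sequentially"
      by (intro filterlim_Pair filterlim_ident)
    \<comment> \<open>The rescaled \<open>b\<close> is evaluated at the moving point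
      \<open>?a n\<close>; the factors \<open>s n\<close> in between cancel.\<close>
    from filterlim_compose[OF b0 this]
    have 1: "(\<lambda>n. b (a (s n *\<^sub>R x)) /\<^sub>R s n) \<longlonglongrightarrow> b0 (a0 x)"
      by (simp add: s[THEN less_imp_neq, THEN not_sym])
    have "\<forall>\<^sub>F n in sequentially. b (a (s n *\<^sub>R x)) = s n *\<^sub>R x"
      using eventually_compose_filterlim[OF ba filterlim_compose[OF lim0 const]] by simp
    then have "\<forall>\<^sub>F n in sequentially. b (a (s n *\<^sub>R x)) /\<^sub>R s n = x"
    proof eventually_elim
      case (elim n)
      then show ?case using s[of n] by simp
    qed
    then show ?thesis
      by (rule LIMSEQ_unique[OF 1 tendsto_eventually])
  qed
  have inv: "\<psi>0 (\<phi>0 x) = x" "\<phi>0 (\<psi>0 x) = x" for x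
    by (rule inverse[where a = \<phi>' and b = \<psi>', OF *(6) \<phi>0 \<psi>0],
        rule inverse[where a = \<psi>' and b = \<phi>', OF *(7) \<psi>0 \<phi>0])
  show ?thesis
  proof (rule that[OF r])
    show "homeomorphism UNIV UNIV \<phi>0 \<psi>0"
      using lipschitz_on_continuous_on[OF r1(2)] lipschitz_on_continuous_on[OF r2(2)] inv
      by (intro homeomorphismI) auto
    have "filterlim (\<lambda>n. (n, 0::'a)) (sequentially \<times>\<^sub>F nhds 0) sequentially"
      by (intro filterlim_Pair filterlim_ident tendsto_const)
    from filterlim_compose[OF \<phi>0 this] show "\<phi>0 0 = 0"
      by (simp add: *(3) LIMSEQ_const_iff)
    show "\<forall>x. ((\<lambda>(n, y). \<phi> (t ((r1 \<circ> r2) n) *\<^sub>R y) /\<^sub>R t ((r1 \<circ> r2) n)) \<longlongrightarrow> \<phi>0 x) (sequentially \<times>\<^sub>F nhds x)"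
    proof
      fix x
      have "\<forall>\<^sub>F p in sequentially \<times>\<^sub>F nhds x. \<phi>' (s (fst p) *\<^sub>R snd p) = \<phi> (s (fst p) *\<^sub>R snd p)"
        using eventually_compose_filterlim[OF *(5) lim0[of x]] by (simp add: case_prod_unfold)
      then have "\<forall>\<^sub>F p in sequentially \<times>\<^sub>F nhds x.
          (case p of (n, y) \<Rightarrow> \<phi>' (s n *\<^sub>R y) /\<^sub>R s n) = (case p of (n, y) \<Rightarrow> \<phi> (s n *\<^sub>R y) /\<^sub>R s n)"
        by eventually_elim (simp add: case_prod_unfold)
      from Lim_transform_eventually[OF \<phi>0 this]
      show "((\<lambda>(n, y). \<phi> (t ((r1 \<circ> r2) n) *\<^sub>R y) /\<^sub>R t ((r1 \<circ> r2) n)) \<longlongrightarrow> \<phi>0 x) (sequentially \<times>\<^sub>F nhds x)"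
        by (simp add: s_def)
    qed
  qed
qed

section \<open>Comparison of the initial forms\<close>

text \<open>If \<open>g\<close> had the larger order, the Lipschitz bounds would make
  \<open>f\<close> of that order of smallness, and \<open>f (t x) / t ^ ord_0 f\<close> would tend
  to 0 even where the initial form of \<open>f\<close> is nonzero. One-sided Lipschitz hypotheses
  let it be applied in both directions.\<close>

lemma ord_0_le:
  fixes f g :: "complex ^ 'n \<Rightarrow> complex"
  assumes f: "holomorphic_germ f" "\<not> (\<forall>\<^sub>F x in nhds 0. f x = 0)" and g: "holomorphic_germ g"
    and \<Phi>: "D-lipschitz_on UNIV \<Phi>" "\<Phi> 0 = 0" and \<phi>: "C-lipschitz_on UNIV \<phi>" "\<phi> 0 = 0"
    and eq: "\<forall>\<^sub>F x in nhds 0. f x = \<Phi> (g (\<phi> x))"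
  shows "ord_0 g \<le> ord_0 f"
proof (rule ccontr)
  let ?m = "ord_0 f" and ?k = "ord_0 g"
  assume "\<not> ?k \<le> ?m"
  then obtain d where d: "?k = Suc (?m + d)"
    using less_imp_Suc_add by (metis not_le)
  obtain x where x: "initial_form f x \<noteq> 0"
    using initial_form_nonzero[OF f] .
  obtain A where A: "A \<ge> 0" "\<forall>\<^sub>F y in nhds 0. norm (g y) \<le> A * norm y ^ ?k"
    using holomorphic_germ_growth[OF g] .
  have C: "C \<ge> 0" and D: "D \<ge> 0"
    using \<phi>(1) \<Phi>(1) lipschitz_on_nonneg by blast+
  have "\<forall>\<^sub>F x in nhds 0. norm (g (\<phi> x)) \<le> A * norm (\<phi> x) ^ ?k"
    by (rule eventually_compose_filterlim[OF A(2) lipschitz_on_filterlim_nhds_0[OF \<phi>]])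
  then have bound: "\<forall>\<^sub>F x in nhds 0. norm (f x) \<le> D * A * C ^ ?k * norm x ^ ?k"
    using eq
  proof eventually_elim
    case (elim x)
    have "norm (\<phi> x) \<le> C * norm x"
      using lipschitz_onD[OF \<phi>(1), of x 0] \<phi>(2) by simp
    then have "norm (\<phi> x) ^ ?k \<le> (C * norm x) ^ ?k"
      by (intro power_mono) auto
    then have "A * norm (\<phi> x) ^ ?k \<le> A * (C * norm x) ^ ?k"
      using A(1) by (intro mult_left_mono)
    with elim(1) have "norm (g (\<phi> x)) \<le> A * (C * norm x) ^ ?k"
      by simp
    then have "D * norm (g (\<phi> x)) \<le> D * (A * (C * norm x) ^ ?k)"
      using D by (intro mult_left_mono)
    moreover have "norm (f x) \<le> D * norm (g (\<phi> x))"
      using lipschitz_onD[OF \<Phi>(1), of "g (\<phi> x)" 0] \<Phi>(2) elim(2) by simp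
    ultimately show ?case
      by (simp add: power_mult_distrib mult.assoc)
  qed
  define t where "t n = inverse (real (Suc n))" for n
  have t: "t n > 0" "t \<longlonglongrightarrow> 0" for n
    unfolding t_def using LIMSEQ_inverse_real_of_nat by auto
  let ?q = "\<lambda>n. f (t n *\<^sub>R x) /\<^sub>R t n ^ ?m"
  have "(\<lambda>n. t n *\<^sub>R x) \<longlonglongrightarrow> 0"
    using tendsto_scaleR[OF t(2) tendsto_const[of x]] by simp
  from eventually_compose_filterlim[OF bound this]
  have "\<forall>\<^sub>F n in sequentially. norm (f (t n *\<^sub>R x)) \<le> D * A * C ^ ?k * norm (t n *\<^sub>R x) ^ ?k" .
  then have "\<forall>\<^sub>F n in sequentially. norm (?q n) \<le> D * A * C ^ ?k * norm x ^ ?k * t n ^ Suc d"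
  proof eventually_elim
    case (elim n)
    have "norm (?q n) = norm (f (t n *\<^sub>R x)) / t n ^ ?m"
      using t(1)[of n] by (simp add: divide_inverse mult.commute)
    also have "\<dots> \<le> D * A * C ^ ?k * norm (t n *\<^sub>R x) ^ ?k / t n ^ ?m"
      using elim t(1)[of n] by (intro divide_right_mono) auto
    also have "\<dots> = D * A * C ^ ?k * norm x ^ ?k * t n ^ Suc d"
      using t(1)[of n] unfolding norm_scaleR power_mult_distrib
      by (simp add: d power_add field_simps)
    finally show ?case .
  qed
  moreover have "(\<lambda>n. D * A * C ^ ?k * norm x ^ ?k * t n ^ Suc d) \<longlonglongrightarrow> D * A * C ^ ?k * norm x ^ ?k * 0 ^ Suc d"
    by (intro tendsto_intros t)
  ultimately have "?q \<longlonglongrightarrow> 0"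
    using Lim_null_comparison[of ?q "\<lambda>n. D * A * C ^ ?k * norm x ^ ?k * t n ^ Suc d" sequentially] by simp
  moreover have "?q \<longlonglongrightarrow> initial_form f x"
    by (rule initial_form_blow_up[OF f(1) t tendsto_const])
  ultimately show False
    using x LIMSEQ_unique[of ?q 0 "initial_form f x"] by simp
qed

lemma bilipschitz_equivalent_ord_0_eq:
  fixes f g :: "complex ^ 'n \<Rightarrow> complex"
  assumes f: "holomorphic_germ f" "f 0 = 0" "\<not> (\<forall>\<^sub>F x in nhds 0. f x = 0)"
    and g: "holomorphic_germ g" "g 0 = 0" "\<not> (\<forall>\<^sub>F x in nhds 0. g x = 0)"
    and \<phi>: "bilipschitz_homeo_germ \<phi>" and \<Phi>: "bilipschitz_homeo_germ \<Phi>"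
    and eq: "\<forall>\<^sub>F x in nhds 0. f x = \<Phi> (g (\<phi> x))"
  shows "ord_0 f = ord_0 g"
proof (rule antisym)
  obtain C \<phi>' \<psi>' where \<phi>': "C-lipschitz_on UNIV \<phi>'" "C-lipschitz_on UNIV \<psi>'" "\<phi>' 0 = 0" "\<psi>' 0 = 0"
    "\<forall>\<^sub>F x in nhds 0. \<phi>' x = \<phi> x"
    "\<forall>\<^sub>F x in nhds 0. \<psi>' (\<phi>' x) = x" "\<forall>\<^sub>F x in nhds 0. \<phi>' (\<psi>' x) = x"
    using bilipschitz_homeo_germ_extension[OF \<phi>] .
  obtain D \<Phi>' \<Psi>' where \<Phi>': "D-lipschitz_on UNIV \<Phi>'" "D-lipschitz_on UNIV \<Psi>'" "\<Phi>' 0 = 0" "\<Psi>' 0 = 0"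
    "\<forall>\<^sub>F z in nhds 0. \<Phi>' z = \<Phi> z"
    "\<forall>\<^sub>F z in nhds 0. \<Psi>' (\<Phi>' z) = z" "\<forall>\<^sub>F z in nhds 0. \<Phi>' (\<Psi>' z) = z"
    using bilipschitz_homeo_germ_extension[OF \<Phi>] .
  obtain A where A: "\<forall>\<^sub>F y in nhds 0. norm (g y) \<le> A * norm y ^ ord_0 g"
    using holomorphic_germ_growth[OF g(1)] by blast
  have "((\<lambda>y. A * norm y ^ ord_0 g) \<longlongrightarrow> A * norm (0 :: complex ^ 'n) ^ ord_0 g) (nhds (0 :: complex ^ 'n))"
    by (intro tendsto_mult tendsto_power tendsto_const tendsto_norm[OF filterlim_ident])
  \<comment> \<open>Continuity of \<open>g\<close> at 0, from the growth bound and the positive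
    order. It brings the values of \<open>g\<close> into the region where the identities for
    \<open>\<Phi>'\<close> and \<open>\<Psi>'\<close> hold.\<close>
  then have g0: "filterlim g (nhds 0) (nhds 0)"
    using Lim_null_comparison[OF A] ord_0_pos[OF g] by (simp add: power_0_left)
  have f': "\<forall>\<^sub>F x in nhds 0. f x = \<Phi>' (g (\<phi>' x))"
  proof -
    have "\<forall>\<^sub>F x in nhds 0. \<Phi>' (g (\<phi>' x)) = \<Phi> (g (\<phi>' x))"
      by (rule eventually_compose_filterlim[OF \<Phi>'(5)
            filterlim_compose[OF g0 lipschitz_on_filterlim_nhds_0[OF \<phi>'(1,3)]]])
    then show ?thesis
      using eq \<phi>'(5) by eventually_elim simp
  qed
  then show "ord_0 g \<le> ord_0 f"
    using ord_0_le[OF f(1,3) g(1) \<Phi>'(1,3) \<phi>'(1,3)] by blast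
  \<comment> \<open>For the converse inequality the relation is solved for \<open>g\<close> near 0,
    using the extended inverses.\<close>
  have "\<forall>\<^sub>F x in nhds 0. f (\<psi>' x) = \<Phi>' (g (\<phi>' (\<psi>' x)))"
    by (rule eventually_compose_filterlim[OF f' lipschitz_on_filterlim_nhds_0[OF \<phi>'(2,4)]])
  moreover have "\<forall>\<^sub>F x in nhds 0. \<Psi>' (\<Phi>' (g x)) = g x"
    by (rule eventually_compose_filterlim[OF \<Phi>'(6) g0])
  ultimately have "\<forall>\<^sub>F x in nhds 0. g x = \<Psi>' (f (\<psi>' x))"
    using \<phi>'(7) by eventually_elim simp
  then show "ord_0 f \<le> ord_0 g"
    using ord_0_le[OF g(1,3) f(1) \<Phi>'(2,4) \<phi>'(2,4)] by blast
qed

text \<open>Source and target are rescaled differently, by \<open>T\<close> and by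
  \<open>T ^ m\<close>, since \<open>f\<close> and \<open>g\<close> share the order
  \<open>m\<close>. With these scales the relation between the germs survives rescaling, and
  convergence at moving points allows the limit in each factor.\<close>

lemma initial_form_bilipschitz_equivalent:
  fixes f g :: "complex ^ 'n \<Rightarrow> complex"
  assumes f: "holomorphic_germ f" "f 0 = 0" "\<not> (\<forall>\<^sub>F x in nhds 0. f x = 0)"
    and g: "holomorphic_germ g" "g 0 = 0" "\<not> (\<forall>\<^sub>F x in nhds 0. g x = 0)"
    and \<phi>: "bilipschitz_homeo_germ \<phi>" and \<Phi>: "bilipschitz_homeo_germ \<Phi>"
    and eq: "\<forall>\<^sub>F x in nhds 0. f x = \<Phi> (g (\<phi> x))"
  obtains \<phi>0 \<psi>0 \<Phi>0 \<Psi>0 where "homeomorphism UNIV UNIV \<phi>0 \<psi>0" "homeomorphism UNIV UNIV \<Phi>0 \<Psi>0" "\<Phi>0 0 = 0"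
    "\<forall>x. initial_form f x = \<Phi>0 (initial_form g (\<phi>0 x))"
proof -
  define m where "m = ord_0 f"
  have m: "ord_0 f = m" "ord_0 g = m" "m > 0"
    using bilipschitz_equivalent_ord_0_eq[OF assms] ord_0_pos[OF f] by (simp_all add: m_def)
  define t where "t n = inverse (real (Suc n))" for n
  have t: "t n > 0" "t \<longlonglongrightarrow> 0" for n
    unfolding t_def using LIMSEQ_inverse_real_of_nat by auto
  obtain r \<phi>0 \<psi>0 where r: "strict_mono (r :: nat \<Rightarrow> nat)" "homeomorphism UNIV UNIV \<phi>0 \<psi>0" "\<phi>0 0 = 0"
    "\<forall>x. ((\<lambda>(n, y). \<phi> (t (r n) *\<^sub>R y) /\<^sub>R t (r n)) \<longlongrightarrow> \<phi>0 x) (sequentially \<times>\<^sub>F nhds x)"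
    using bilipschitz_homeo_germ_blow_up[OF \<phi> t] .
  have tr: "t (r n) ^ m > 0" "(\<lambda>n. t (r n) ^ m) \<longlonglongrightarrow> 0" for n
    using t(1) tendsto_power[OF LIMSEQ_subseq_LIMSEQ[OF t(2) r(1)], of m] m(3)
    by (simp_all add: o_def power_0_left)
  \<comment> \<open>\<open>\<Phi>\<close> is blown up along the scales \<open>t (r n) ^ m\<close>,
    on a further subsequence where the blow-up of \<open>\<phi>\<close> still converges.\<close>
  obtain s \<Phi>0 \<Psi>0 where s: "strict_mono (s :: nat \<Rightarrow> nat)" "homeomorphism UNIV UNIV \<Phi>0 \<Psi>0" "\<Phi>0 0 = 0"
    "\<forall>z. ((\<lambda>(n, y). \<Phi> (t (r (s n)) ^ m *\<^sub>R y) /\<^sub>R t (r (s n)) ^ m) \<longlongrightarrow> \<Phi>0 z) (sequentially \<times>\<^sub>F nhds z)"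
    using bilipschitz_homeo_germ_blow_up[where t = "\<lambda>n. t (r n) ^ m", OF \<Phi> tr] .
  define T where "T n = t (r (s n))" for n
  have T: "T n > 0" "T \<longlonglongrightarrow> 0" for n
    using t(1) LIMSEQ_subseq_LIMSEQ[OF t(2) strict_mono_o[OF r(1) s(1)]] by (simp_all add: T_def[abs_def] o_def)
  have "initial_form f x = \<Phi>0 (initial_form g (\<phi>0 x))" for x
  proof -
    define y where "y n = \<phi> (T n *\<^sub>R x) /\<^sub>R T n" for n
    define z where "z n = g (T n *\<^sub>R y n) /\<^sub>R T n ^ m" for n
    have "filterlim (\<lambda>n. (s n, x)) (sequentially \<times>\<^sub>F nhds x) sequentially"
      by (intro filterlim_Pair filterlim_subseq[OF s(1)] tendsto_const)
    from filterlim_compose[OF r(4)[rule_format] this] have y: "y \<longlonglongrightarrow> \<phi>0 x"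
      by (simp add: y_def[abs_def] T_def)
    have z: "z \<longlonglongrightarrow> initial_form g (\<phi>0 x)"
      unfolding z_def using initial_form_blow_up[OF g(1) T y] m by simp
    have "filterlim (\<lambda>n. (n, z n)) (sequentially \<times>\<^sub>F nhds (initial_form g (\<phi>0 x))) sequentially"
      by (intro filterlim_Pair filterlim_ident z)
    from filterlim_compose[OF s(4)[rule_format] this]
    have \<Phi>z: "(\<lambda>n. \<Phi> (T n ^ m *\<^sub>R z n) /\<^sub>R T n ^ m) \<longlonglongrightarrow> \<Phi>0 (initial_form g (\<phi>0 x))"
      by (simp add: T_def)
    have "\<forall>\<^sub>F n in sequentially. f (T n *\<^sub>R x) = \<Phi> (g (\<phi> (T n *\<^sub>R x)))"
      using eventually_compose_filterlim[OF eq, of "\<lambda>n. T n *\<^sub>R x"]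
        tendsto_scaleR[OF T(2) tendsto_const[of x]] by simp
    then have "\<forall>\<^sub>F n in sequentially. \<Phi> (T n ^ m *\<^sub>R z n) /\<^sub>R T n ^ m = f (T n *\<^sub>R x) /\<^sub>R T n ^ m"
    proof eventually_elim
      case (elim n)
      then show ?case using T(1)[of n] by (simp add: z_def y_def)
    qed
    from Lim_transform_eventually[OF \<Phi>z this]
    have "(\<lambda>n. f (T n *\<^sub>R x) /\<^sub>R T n ^ m) \<longlonglongrightarrow> \<Phi>0 (initial_form g (\<phi>0 x))" .
    moreover have "(\<lambda>n. f (T n *\<^sub>R x) /\<^sub>R T n ^ m) \<longlonglongrightarrow> initial_form f x"
      using initial_form_blow_up[OF f(1) T tendsto_const] m by simp
    ultimately show ?thesis
      by (rule LIMSEQ_unique[rotated])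
  qed
  then show ?thesis
    using that[OF r(2) s(2,3)] by blast
qed

section \<open>From the relation between initial forms to the Milnor fibres\<close>

lemma complex_root_exists:
  assumes "(c::complex) \<noteq> 0" "m > 0"
  obtains w where "w \<noteq> 0" "w ^ m = c"
proof
  show "exp (Ln c / of_nat m) ^ m = c"
    using assms by (simp flip: exp_of_nat_mult)
qed simp

theorem corollary2p6:
  fixes f g :: "complex ^ 'n \<Rightarrow> complex"
    and \<phi> :: "complex ^ 'n \<Rightarrow> complex ^ 'n"
    and \<Phi> :: "complex \<Rightarrow> complex"
  assumes "holomorphic_germ f" and "f 0 = 0" and "\<not> (\<forall>\<^sub>F x in nhds 0. f x = 0)"
    and "holomorphic_germ g" and "g 0 = 0" and "\<not> (\<forall>\<^sub>F x in nhds 0. g x = 0)"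
    and "bilipschitz_homeo_germ \<phi>" and "bilipschitz_homeo_germ \<Phi>"
    and "\<forall>\<^sub>F x in nhds 0. f x = (\<Phi> \<circ> g \<circ> \<phi>) x"
  shows "milnor_fibre (initial_form f) homotopy_eqv milnor_fibre (initial_form g)"
proof -
  let ?p = "initial_form f" and ?q = "initial_form g" and ?m = "ord_0 g"
  obtain \<phi>0 \<psi>0 \<Phi>0 \<Psi>0 where hom: "homeomorphism UNIV UNIV \<phi>0 \<psi>0" "homeomorphism UNIV UNIV \<Phi>0 \<Psi>0"
    and "\<Phi>0 0 = 0" and p: "\<forall>x. ?p x = \<Phi>0 (?q (\<phi>0 x))"
    using initial_form_bilipschitz_equivalent[OF assms(1-8) assms(9)[unfolded o_apply]] .
  have inv: "\<psi>0 (\<phi>0 x) = x" "\<phi>0 (\<psi>0 x) = x" "\<Psi>0 (\<Phi>0 z) = z" "\<Phi>0 (\<Psi>0 z) = z" for x z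
    using homeomorphism_apply1[OF hom(1)] homeomorphism_apply2[OF hom(1)]
      homeomorphism_apply1[OF hom(2)] homeomorphism_apply2[OF hom(2)] by auto
  have "\<Psi>0 1 \<noteq> 0"
    using inv(4)[of 1] \<open>\<Phi>0 0 = 0\<close> by auto
  \<comment> \<open>\<open>\<phi>0\<close> carries the Milnor fibre of \<open>?p\<close> onto the
    level set of \<open>?q\<close> at \<open>\<Psi>0 1\<close>. By homogeneity, dilation by
    \<open>inverse w\<close> moves that level to 1.\<close>
  then obtain w where w: "w \<noteq> 0" "w ^ ?m = \<Psi>0 1"
    using complex_root_exists ord_0_pos[OF assms(4-6)] by blast
  have p_iff: "?p x = 1 \<longleftrightarrow> ?q (\<phi>0 x) = w ^ ?m" for x
    using p inv(3,4) w(2) by metis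
  have q_scale: "?q (a *s y) = a ^ ?m * ?q y" for a y
    by (rule homogeneous_poly_scale[OF homogeneous_poly_initial_form[OF assms(4)]])
  have "homeomorphism (milnor_fibre ?p) (milnor_fibre ?q) (\<lambda>x. inverse w *s \<phi>0 x) (\<lambda>y. \<psi>0 (w *s y))"
  proof (rule homeomorphismI)
    show "continuous_on (milnor_fibre ?p) (\<lambda>x. inverse w *s \<phi>0 x)"
      using homeomorphism_cont1[OF hom(1)] by (intro continuous_intros) (rule continuous_on_subset, auto)
    show "continuous_on (milnor_fibre ?q) (\<lambda>y. \<psi>0 (w *s y))"
      by (rule continuous_on_compose2[OF homeomorphism_cont2[OF hom(1)]]) (auto intro!: continuous_intros)
  qed (use w(1) in \<open>auto simp: milnor_fibre_def p_iff q_scale inv power_inverse\<close>)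
  then show ?thesis
    by (intro homeomorphic_imp_homotopy_eqv) (auto simp: homeomorphic_def)
qed

end
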